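(* The functor $\mathcal{P}_{\mathcal{M}}$ (the hyperdoctrine of mass problems, defined in the context) is a first-order hyperdoctrine.
   Context: Notation. A mass problem is a subset of Baire space $\omega^\omega$. For $f,g\in\omega^\omega$, $f\oplus g$ is given by $(f\oplus g)(2n)=f(n)$, $(f\oplus g)(2n+1)=g(n)$; for $n\in\omega$, $n^\frown f$ is the function whose first value is $n$ followed by $f$, and $n^\frown\mathcal{A}=\{n^\frown f: f\in\mathcal{A}\}$. $\Phi_e$ is the $e$-th partial Turing functional; $\langle a_1,\dots,a_n\rangle$ is a fixed computable bijection $\omega^n\to\omega$. Medvedev reducibility: $\mathcal{A}\le_{\mathcal{M}}\mathcal{B}$ iff there is a partial Turing functional $\Phi$ with $\Phi(\mathcal{B})\subseteq\mathcal{A}$. The Medvedev lattice $\mathcal{M}$ is the set of equivalence classes; it is a Brouwer algebra (bounded distributive lattice with implication $\to$ such that $x\oplus y\ge z$ iff $y\ge x\to z$) with join $\mathcal{A}\oplus\mathcal{B}=\{f\oplus g: f\in\mathcal{A},g\in\mathcal{B}\}$, meet $\mathcal{A}\otimes\mathcal{B}=0^\frown\mathcal{A}\cup 1^\frown\mathcal{B}$, implication $\mathcal{A}\to\mathcal{B}=\{e^\frown f:\forall g\in\mathcal{A}\,(\Phi_e(g\oplus f)\in\mathcal{B})\}$; bottom is the degree of $\omega^\omega$, top is the degree of $\emptyset$. $\mathcal{M}^n$ is the $n$-fold product with componentwise order and operations. $\omega$-mass problems: an $\omega$-mass problem is a sequence $(\mathcal{A}_i)_{i\in\omega}$ of mass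 problems; $(\mathcal{A}_i)_i\le_{\mathcal{M}_\omega}(\mathcal{B}_i)_i$ iff there is a single partial Turing functional $\Phi$ with $\Phi(n^\frown\mathcal{B}_n)\subseteq\mathcal{A}_n$ for every $n$. $\mathcal{M}_\omega$ denotes the set of equivalence classes (a Brouwer algebra under componentwise operations). First-order hyperdoctrine. Let $\mathbf{C}$ be a category in which all finite powers $X^n$ of objects exist. A first-order hyperdoctrine over $\mathbf{C}$ is a contravariant functor $\mathcal{P}:\mathbf{C}^{op}\to\mathbf{Poset}$ such that: (i) each $\mathcal{P}(X)$ is a Brouwer algebra; (ii) for each morphism $f:X\to Y$, $f^*=\mathcal{P}(f):\mathcal{P}(Y)\to\mathcal{P}(X)$ is a Brouwer algebra homomorphism; (iii) for each diagonal $\Delta_X:X\to X\times X$ there is an element $=_X\in\mathcal{P}(X\times X)$ such that for all $A\in\mathcal{P}(X\times X)$: $\Delta_X^*(A)\le 0$ iff $A\le{=_X}$; (iv) for each product projection $\pi:\Gamma\times X\to\Gamma$, $\pi^*$ has a right adjoint $(\exists x)_\Gamma$ and a left adjoint $(\forall x)_\Gamma$ (i.e. $\pi^*(B)\le A$ iff $B\le(\exists x)_\Gamma(A)$, and $A\le\pi^*(B)$ iff $(\forall x)_\Gamma(A)\le B$), and these are natural in $\Gamma$ (Beck–Chevalley condition): for every $s:\Gamma\to\Gamma'$, $(\exists x)_\Gamma\circ(s\times 1_X)^*=s^*\circ(\exists x)_{\Gamma'}$ and $(\forall x)_\Gamma\circ(s\times 1_X)^*=s^*\circ(\forall x)_{\Gamma'}$.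 The hyperdoctrine of mass problems $\mathcal{P}_{\mathcal{M}}$: $\mathbf{C}$ is the category with objects $\{1\},\{1,2\},\{1,2,3\},\dots$ and $\omega$, and morphisms all computable functions between them (products $\omega^n$ identified with $\omega$ via $\langle\cdot\rangle$, and $\{1,\dots,m\}^n$ with $\{1,\dots,m^n\}$ via a fixed computable bijection). $\mathcal{P}_{\mathcal{M}}$ sends $\{1,\dots,n\}$ to $\mathcal{M}^n$, $\omega$ to $\mathcal{M}_\omega$, and a computable $\alpha:X\to Y$ to $\alpha^*:\mathcal{P}_{\mathcal{M}}(Y)\to\mathcal{P}_{\mathcal{M}}(X)$, $(\alpha^*((\mathcal{A}_j)_{j\in Y}))_i=\mathcal{A}_{\alpha(i)}$. *)

theory Defs
  imports "HOL-Algebra.Lattice"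
begin

section \<open>Turing functionals\<close>

text \<open>
  Computability relative to an oracle is given by Kleene's partial recursive functions with an
  additional initial function, the oracle. \<^term>\<open>eval f p xs y\<close> says that the program
  \<^term>\<open>p\<close> with oracle \<^term>\<open>f\<close> halts on the arguments \<^term>\<open>xs\<close> with value \<^term>\<open>y\<close>.
  Programs carry no arity; on argument lists of an unsuitable length they have no value.
\<close>

datatype recf =
    Zero
  | Succ
  | Proj nat
  | Oracle
  | Comp recf "recf list"
  | Prim recf recf
  | Mu recf

inductive eval :: "(nat \<Rightarrow> nat) \<Rightarrow> recf \<Rightarrow> nat list \<Rightarrow> nat \<Rightarrow> bool" for f where
  zero: "eval f Zero xs 0"
| succ: "eval f Succ [x] (Suc x)"
| proj: "i < length xs \<Longrightarrow> eval f (Proj i) xs (xs ! i)"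
| query: "eval f Oracle [x] (f x)"
| comp: "list_all2 (\<lambda>p y. eval f p xs y) ps ys \<Longrightarrow> eval f q ys z \<Longrightarrow> eval f (Comp q ps) xs z"
| prim_0: "eval f p xs y \<Longrightarrow> eval f (Prim p q) (0 # xs) y"
| prim_Suc: "eval f (Prim p q) (n # xs) y \<Longrightarrow> eval f q (y # n # xs) z
    \<Longrightarrow> eval f (Prim p q) (Suc n # xs) z"
| mu: "eval f p (n # xs) 0 \<Longrightarrow> \<forall>m<n. \<exists>y. eval f p (m # xs) (Suc y) \<Longrightarrow> eval f (Mu p) xs n"

text \<open>A partial Turing functional is defined at \<^term>\<open>f\<close> iff its program with oracle
  \<^term>\<open>f\<close> computes a total function.\<close>

definition turing_functional :: "((nat \<Rightarrow> nat) \<rightharpoonup> (nat \<Rightarrow> nat)) \<Rightarrow> bool" where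
  "turing_functional \<Phi> \<longleftrightarrow> (\<exists>p. \<forall>f g. \<Phi> f = Some g \<longleftrightarrow> (\<forall>n. eval f p [n] (g n)))"

text \<open>Computability without an oracle is computability relative to the constant zero oracle.\<close>

definition computable_on :: "nat set \<Rightarrow> (nat \<Rightarrow> nat) \<Rightarrow> bool" where
  "computable_on X \<alpha> \<longleftrightarrow> (\<exists>p. \<forall>i\<in>X. eval (\<lambda>_. 0) p [i] (\<alpha> i))"


section \<open>Mass problems\<close>

type_synonym mass_problem = "(nat \<Rightarrow> nat) set"

text \<open>\<^term>\<open>maps_into \<Phi> \<B> \<A>\<close> renders \<open>\<Phi>(\<B>) \<subseteq> \<A>\<close>, which includes that \<^term>\<open>\<Phi>\<close> is defined on
  all of \<^term>\<open>\<B>\<close>.\<close>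

definition maps_into :: "((nat \<Rightarrow> nat) \<rightharpoonup> (nat \<Rightarrow> nat)) \<Rightarrow> mass_problem \<Rightarrow> mass_problem \<Rightarrow> bool" where
  "maps_into \<Phi> \<B> \<A> \<longleftrightarrow> (\<forall>g\<in>\<B>. \<exists>f\<in>\<A>. \<Phi> g = Some f)"

definition prepend :: "nat \<Rightarrow> mass_problem \<Rightarrow> mass_problem" where
  "prepend n \<A> = case_nat n ` \<A>"

definition medvedev_le :: "mass_problem \<Rightarrow> mass_problem \<Rightarrow> bool" where
  "medvedev_le \<A> \<B> \<longleftrightarrow> (\<exists>\<Phi>. turing_functional \<Phi> \<and> maps_into \<Phi> \<B> \<A>)"

definition medvedev_omega_le :: "(nat \<Rightarrow> mass_problem) \<Rightarrow> (nat \<Rightarrow> mass_problem) \<Rightarrow> bool" where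
  "medvedev_omega_le \<A> \<B> \<longleftrightarrow>
     (\<exists>\<Phi>. turing_functional \<Phi> \<and> (\<forall>n. maps_into \<Phi> (prepend n (\<B> n)) (\<A> n)))"

definition equiv_of :: "('x \<Rightarrow> 'x \<Rightarrow> bool) \<Rightarrow> ('x \<times> 'x) set" where
  "equiv_of R = {(a, b). R a b \<and> R b a}"

text \<open>The order induced on equivalence classes.\<close>

definition class_le :: "('x \<Rightarrow> 'x \<Rightarrow> bool) \<Rightarrow> 'x set \<Rightarrow> 'x set \<Rightarrow> bool" where
  "class_le R D E \<longleftrightarrow> (\<exists>a\<in>D. \<exists>b\<in>E. R a b)"

definition medvedev_degrees :: "mass_problem set set" where
  "medvedev_degrees = UNIV // equiv_of medvedev_le"

definition medvedev_omega_degrees :: "(nat \<Rightarrow> mass_problem) set set" where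
  "medvedev_omega_degrees = UNIV // equiv_of medvedev_omega_le"


section \<open>Brouwer algebras\<close>

text \<open>The operations are determined by the order, so a Brouwer algebra is a poset with a
  property. Note the direction of the order: the implication is adjoint to the join.\<close>

locale brouwer_algebra = bounded_lattice +
  assumes distributive: "\<lbrakk>x \<in> carrier L; y \<in> carrier L; z \<in> carrier L\<rbrakk>
      \<Longrightarrow> x \<sqinter> (y \<squnion> z) = (x \<sqinter> y) \<squnion> (x \<sqinter> z)"
    and implication_exists: "\<lbrakk>x \<in> carrier L; z \<in> carrier L\<rbrakk>
      \<Longrightarrow> \<exists>w\<in>carrier L. \<forall>y\<in>carrier L. z \<sqsubseteq> x \<squnion> y \<longleftrightarrow> w \<sqsubseteq> y"

definition implication :: "('p, 'b) gorder_scheme \<Rightarrow> 'p \<Rightarrow> 'p \<Rightarrow> 'p" where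
  "implication L x z =
     (THE w. w \<in> carrier L \<and> (\<forall>y\<in>carrier L. z \<sqsubseteq>\<^bsub>L\<^esub> x \<squnion>\<^bsub>L\<^esub> y \<longleftrightarrow> w \<sqsubseteq>\<^bsub>L\<^esub> y))"

definition brouwer_hom ::
    "('p, 'b) gorder_scheme \<Rightarrow> ('q, 'c) gorder_scheme \<Rightarrow> ('p \<Rightarrow> 'q) \<Rightarrow> bool" where
  "brouwer_hom L M h \<longleftrightarrow>
     h \<in> carrier L \<rightarrow> carrier M \<and>
     h \<bottom>\<^bsub>L\<^esub> = \<bottom>\<^bsub>M\<^esub> \<and> h \<top>\<^bsub>L\<^esub> = \<top>\<^bsub>M\<^esub> \<and>
     (\<forall>x\<in>carrier L. \<forall>y\<in>carrier L.
        h (x \<squnion>\<^bsub>L\<^esub> y) = h x \<squnion>\<^bsub>M\<^esub> h y \<and>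
        h (x \<sqinter>\<^bsub>L\<^esub> y) = h x \<sqinter>\<^bsub>M\<^esub> h y \<and>
        h (implication L x y) = implication M (h x) (h y))"


section \<open>Categories and products\<close>

record ('o, 'a) cat =
  Obj :: "'o set"
  Arr :: "'a set"
  Dom :: "'a \<Rightarrow> 'o"
  Cod :: "'a \<Rightarrow> 'o"
  Id :: "'o \<Rightarrow> 'a"
  Cmp :: "'a \<Rightarrow> 'a \<Rightarrow> 'a"

text \<open>\<^term>\<open>Cmp C g f\<close> is \<^term>\<open>g\<close> after \<^term>\<open>f\<close>.\<close>

definition hom :: "('o, 'a) cat \<Rightarrow> 'o \<Rightarrow> 'o \<Rightarrow> 'a set" where
  "hom C X Y = {f \<in> Arr C. Dom C f = X \<and> Cod C f = Y}"

locale category =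
  fixes C :: "('o, 'a) cat"
  assumes dom_cod: "f \<in> Arr C \<Longrightarrow> Dom C f \<in> Obj C \<and> Cod C f \<in> Obj C"
    and id_hom: "X \<in> Obj C \<Longrightarrow> Id C X \<in> hom C X X"
    and comp_hom: "\<lbrakk>f \<in> hom C X Y; g \<in> hom C Y Z\<rbrakk> \<Longrightarrow> Cmp C g f \<in> hom C X Z"
    and id_left: "f \<in> hom C X Y \<Longrightarrow> Cmp C (Id C Y) f = f"
    and id_right: "f \<in> hom C X Y \<Longrightarrow> Cmp C f (Id C X) = f"
    and assoc: "\<lbrakk>f \<in> hom C W X; g \<in> hom C X Y; h \<in> hom C Y Z\<rbrakk>
      \<Longrightarrow> Cmp C h (Cmp C g f) = Cmp C (Cmp C h g) f"

definition is_product :: "('o, 'a) cat \<Rightarrow> 'o list \<Rightarrow> 'o \<Rightarrow> 'a list \<Rightarrow> bool" where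
  "is_product C Xs Q ps \<longleftrightarrow>
     set Xs \<subseteq> Obj C \<and> Q \<in> Obj C \<and> list_all2 (\<lambda>p X. p \<in> hom C Q X) ps Xs \<and>
     (\<forall>Z\<in>Obj C. \<forall>fs. list_all2 (\<lambda>f X. f \<in> hom C Z X) fs Xs \<longrightarrow>
        (\<exists>!h. h \<in> hom C Z Q \<and> map (\<lambda>p. Cmp C p h) ps = fs))"

definition has_finite_powers :: "('o, 'a) cat \<Rightarrow> bool" where
  "has_finite_powers C \<longleftrightarrow> (\<forall>X\<in>Obj C. \<forall>n. \<exists>Q ps. is_product C (replicate n X) Q ps)"


section \<open>First-order hyperdoctrines\<close>

locale contravariant_poset_functor = category C
  for C :: "('o, 'a) cat" +
  fixes P :: "'o \<Rightarrow> 'p gorder"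
    and star :: "'a \<Rightarrow> 'p \<Rightarrow> 'p"
  assumes poset: "X \<in> Obj C \<Longrightarrow> partial_order (P X)"
    and star_closed: "f \<in> hom C X Y \<Longrightarrow> star f \<in> carrier (P Y) \<rightarrow> carrier (P X)"
    and star_isotone: "f \<in> hom C X Y \<Longrightarrow> isotone (P Y) (P X) (star f)"
    and star_id: "\<lbrakk>X \<in> Obj C; A \<in> carrier (P X)\<rbrakk> \<Longrightarrow> star (Id C X) A = A"
    and star_comp: "\<lbrakk>f \<in> hom C X Y; g \<in> hom C Y Z; A \<in> carrier (P Z)\<rbrakk>
      \<Longrightarrow> star (Cmp C g f) A = star f (star g A)"

text \<open>
  Conditions on \<open>X \<times> X\<close> and \<open>\<Gamma> \<times> X\<close> are imposed for every product diagram in the category, so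
  that they hold for whatever choice of products is made. The quantifiers \<open>(\<exists>x)\<^sub>\<Gamma>\<close> and \<open>(\<forall>x)\<^sub>\<Gamma>\<close>
  are indexed by the two projections \<^term>\<open>\<pi>\<close> and \<^term>\<open>\<rho>\<close> of such a diagram, and the arrow
  \<^term>\<open>t\<close> in the Beck-Chevalley conditions is \<open>s \<times> 1\<^sub>X\<close>.
\<close>

locale first_order_hyperdoctrine = contravariant_poset_functor C P star
  for C :: "('o, 'a) cat" and P :: "'o \<Rightarrow> 'p gorder" and star :: "'a \<Rightarrow> 'p \<Rightarrow> 'p" +
  assumes finite_powers: "has_finite_powers C"
    and brouwer: "X \<in> Obj C \<Longrightarrow> brouwer_algebra (P X)"
    and star_hom: "f \<in> hom C X Y \<Longrightarrow> brouwer_hom (P Y) (P X) (star f)"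
    and equality: "\<lbrakk>is_product C [X, X] Q [\<pi>, \<rho>];
        \<Delta> \<in> hom C X Q; Cmp C \<pi> \<Delta> = Id C X; Cmp C \<rho> \<Delta> = Id C X\<rbrakk>
      \<Longrightarrow> \<exists>E\<in>carrier (P Q). \<forall>A\<in>carrier (P Q).
            star \<Delta> A \<sqsubseteq>\<^bsub>P X\<^esub> \<bottom>\<^bsub>P X\<^esub> \<longleftrightarrow> A \<sqsubseteq>\<^bsub>P Q\<^esub> E"
    and quantifiers: "X \<in> Obj C \<Longrightarrow> \<exists>(ex :: 'a \<Rightarrow> 'a \<Rightarrow> 'p \<Rightarrow> 'p) (all :: 'a \<Rightarrow> 'a \<Rightarrow> 'p \<Rightarrow> 'p).
      (\<forall>\<Gamma> Q \<pi> \<rho>. is_product C [\<Gamma>, X] Q [\<pi>, \<rho>] \<longrightarrow>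
         ex \<pi> \<rho> \<in> carrier (P Q) \<rightarrow> carrier (P \<Gamma>) \<and>
         all \<pi> \<rho> \<in> carrier (P Q) \<rightarrow> carrier (P \<Gamma>) \<and>
         (\<forall>A\<in>carrier (P Q). \<forall>B\<in>carrier (P \<Gamma>).
            (star \<pi> B \<sqsubseteq>\<^bsub>P Q\<^esub> A \<longleftrightarrow> B \<sqsubseteq>\<^bsub>P \<Gamma>\<^esub> ex \<pi> \<rho> A) \<and>
            (A \<sqsubseteq>\<^bsub>P Q\<^esub> star \<pi> B \<longleftrightarrow> all \<pi> \<rho> A \<sqsubseteq>\<^bsub>P \<Gamma>\<^esub> B))) \<and>
      (\<forall>\<Gamma> Q \<pi> \<rho> \<Gamma>' Q' \<pi>' \<rho>' s t.
         is_product C [\<Gamma>, X] Q [\<pi>, \<rho>] \<longrightarrow> is_product C [\<Gamma>', X] Q' [\<pi>', \<rho>'] \<longrightarrow>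
         s \<in> hom C \<Gamma> \<Gamma>' \<longrightarrow>
         t \<in> hom C Q Q' \<longrightarrow> Cmp C \<pi>' t = Cmp C s \<pi> \<longrightarrow> Cmp C \<rho>' t = \<rho> \<longrightarrow>
         (\<forall>A\<in>carrier (P Q').
            ex \<pi> \<rho> (star t A) = star s (ex \<pi>' \<rho>' A) \<and>
            all \<pi> \<rho> (star t A) = star s (all \<pi>' \<rho>' A)))"


section \<open>The hyperdoctrine of mass problems\<close>

text \<open>Arrows are triples of domain, function and codomain; the function is
  \<^const>\<open>undefined\<close> outside the domain, so that arrows are compared on the domain only.\<close>

type_synonym arrow = "nat set \<times> (nat \<Rightarrow> nat) \<times> nat set"

definition comp_objects :: "nat set set" where
  "comp_objects = insert UNIV {{1..n} |n. 1 \<le> n}"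

definition comp_category :: "(nat set, arrow) cat" where
  "comp_category =
    \<lparr>Obj = comp_objects,
     Arr = {(X, \<alpha>, Y). X \<in> comp_objects \<and> Y \<in> comp_objects \<and>
              \<alpha> \<in> X \<rightarrow>\<^sub>E Y \<and> computable_on X \<alpha>},
     Dom = (\<lambda>(X, \<alpha>, Y). X),
     Cod = (\<lambda>(X, \<alpha>, Y). Y),
     Id = (\<lambda>X. (X, restrict id X, X)),
     Cmp = (\<lambda>(Y, \<beta>, Z) (X, \<alpha>, Y'). (X, compose X \<beta> \<alpha>, Z))\<rparr>"

text \<open>\<open>Tuple\<close> is used for elements of the finite powers of the Medvedev lattice and \<open>Omega\<close> for
  equivalence classes of \<open>\<omega>\<close>-mass problems.\<close>

datatype predicate =
    Tuple "nat \<Rightarrow> mass_problem set"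
  | Omega "(nat \<Rightarrow> mass_problem) set"

fun predicate_le :: "nat set \<Rightarrow> predicate \<Rightarrow> predicate \<Rightarrow> bool" where
  "predicate_le X (Tuple D) (Tuple E) \<longleftrightarrow> (\<forall>i\<in>X. class_le medvedev_le (D i) (E i))"
| "predicate_le X (Omega D) (Omega E) \<longleftrightarrow> class_le medvedev_omega_le D E"
| "predicate_le X _ _ \<longleftrightarrow> False"

definition mass_P :: "nat set \<Rightarrow> predicate gorder" where
  "mass_P X =
    \<lparr>carrier = (if X = UNIV then Omega ` medvedev_omega_degrees
                else Tuple ` (X \<rightarrow>\<^sub>E medvedev_degrees)),
     eq = (=),
     le = predicate_le X\<rparr>"

text \<open>Reindexing acts on representatives.\<close>

fun representative :: "predicate \<Rightarrow> nat \<Rightarrow> mass_problem" where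
  "representative (Tuple D) j = (SOME \<A>. \<A> \<in> D j)"
| "representative (Omega D) j = (SOME \<A>. \<A> \<in> D) j"

definition predicate_of :: "nat set \<Rightarrow> (nat \<Rightarrow> mass_problem) \<Rightarrow> predicate" where
  "predicate_of X \<A> =
     (if X = UNIV then Omega (equiv_of medvedev_omega_le `` {\<A>})
      else Tuple (\<lambda>i\<in>X. equiv_of medvedev_le `` {\<A> i}))"

definition mass_star :: "arrow \<Rightarrow> predicate \<Rightarrow> predicate" where
  "mass_star = (\<lambda>(X, \<alpha>, Y) v. predicate_of X (\<lambda>i. representative v (\<alpha> i)))"

end

theory Submission
  imports Defs "HOL-Library.Nat_Bijection"
begin

text \<open>
  Both orders of the hyperdoctrine are instances of uniform reducibility of families of mass
  problems over an index set: one program must work for all indices, the index being prepended to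
  the oracle. Over a finite index set uniformity is no restriction. All operations are then
  indexwise: joins are pairs, meets are tagged unions, \<open>\<exists>\<close> is the union of the
  \<open>{j} \<times> A (i, j)\<close> and \<open>\<forall>\<close> consists of sequences of elements of the \<open>A (i, j)\<close>, so that reindexing
  preserves them, and the adjunctions are short reductions.

  Only the implication is delicate. In place of indices of functionals it uses Kleene associates,
  functions that describe a continuous operation by its values on initial segments of the
  argument. That a Turing functional with a parameter has an associate computable from the
  parameter is shown by recursion on the program, running it on a finite piece of the oracle with
  all searches cut off; no universal machine is needed.
\<close>

section \<open>Relative computations\<close>

\<comment> \<open>Easy problems lie at the bottom, so bottom plays the role of truth, and
  \<open>\<exists>\<close> and \<open>\<forall>\<close> are right and left adjoint to reindexing,
  opposite to the usual convention. The order determines join, meet and implication, so any formula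
  with the right adjunction may stand for them. The hard half of the implication is currying: a
  reduction that uses two oracles has to become, uniformly in one of them, a single function that
  describes its action on the other. The conditions on products range over all product diagrams, not
  over one fixed pairing. A computable pairing therefore has to be recovered from the projections
  alone. It is found by search, which is safe because the objects are intervals of numbers. Equality
  is then the trivial problem on the diagonal and the empty problem off it.\<close>
inductive_simps eval_Zero [simp]: "eval f Zero xs y"
inductive_simps eval_Succ [simp]: "eval f Succ [x] y"
inductive_simps eval_Proj [simp]: "eval f (Proj i) xs y"
inductive_simps eval_Oracle [simp]: "eval f Oracle [x] y"
inductive_simps eval_Comp: "eval f (Comp q ps) xs z"
inductive_simps eval_Prim_0 [simp]: "eval f (Prim p q) (0 # xs) y"
inductive_simps eval_Prim_Suc [simp]: "eval f (Prim p q) (Suc n # xs) y"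
inductive_simps eval_Mu: "eval f (Mu p) xs n"

lemma eval_deterministic: "eval f p xs y \<Longrightarrow> eval f p xs z \<Longrightarrow> y = z"
proof (induction arbitrary: z rule: eval.induct)
  case (comp xs ps ys q v)
  from comp.prems obtain zs where zs: "list_all2 (\<lambda>p y. eval f p xs y) ps zs" and v: "eval f q zs z"
    unfolding eval_Comp by blast
  have "ys = zs"
    using comp.IH(1) zs by (auto simp: list_all2_conv_all_nth intro!: nth_equalityI)
  then show ?case using comp.IH(2) v by simp
next
  case (prim_Suc p q n xs y z')
  from prim_Suc.prems obtain y' where "eval f (Prim p q) (n # xs) y'" "eval f q (y' # n # xs) z"
    unfolding eval_Prim_Suc by blast
  then show ?case using prim_Suc.IH by blast
next
  case (mu p n xs)
  from mu.prems have z: "eval f p (z # xs) 0" "\<forall>m<z. \<exists>y. eval f p (m # xs) (Suc y)"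
    unfolding eval_Mu by blast+
  show ?case
  proof (rule linorder_cases[of n z])
    assume "n < z"
    then show ?thesis using z(2) mu.IH(1) by blast
  next
    assume "z < n"
    then show ?thesis using mu.IH(2) z(1) by blast
  qed
qed simp_all

text \<open>It turns one known run of a program into a rewrite rule for all its runs; the many facts
  \<open>eval_iff[OF this]\<close> below hand such rules to the simplifier.\<close>

lemma eval_iff: "eval f p xs y \<Longrightarrow> eval f p xs z \<longleftrightarrow> z = y"
  using eval_deterministic by blast

lemma eval_Comp_1 [simp]: "eval f (Comp q [p]) xs z \<longleftrightarrow> (\<exists>y. eval f p xs y \<and> eval f q [y] z)"
  by (auto simp: eval_Comp list_all2_Cons1)

lemma eval_Comp_2 [simp]: "eval f (Comp q [p, p']) xs z \<longleftrightarrow>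
    (\<exists>y. eval f p xs y \<and> (\<exists>y'. eval f p' xs y' \<and> eval f q [y, y'] z))"
  by (auto simp: eval_Comp list_all2_Cons1)

lemma eval_Comp_3 [simp]: "eval f (Comp q [p, p', p'']) xs z \<longleftrightarrow>
    (\<exists>y. eval f p xs y \<and> (\<exists>y'. eval f p' xs y' \<and> (\<exists>y''. eval f p'' xs y'' \<and> eval f q [y, y', y''] z)))"
  by (auto simp: eval_Comp list_all2_Cons1) blast

lemma eval_PrimI:
  assumes "eval f p xs (h 0)" "\<And>m. m < n \<Longrightarrow> eval f q (h m # m # xs) (h (Suc m))"
  shows "eval f (Prim p q) (n # xs) (h n)"
  using assms by (induction n) auto

subsection \<open>Arithmetic programs and case distinction\<close>

definition "p_add = Prim (Proj 0) (Comp Succ [Proj 0])"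
definition "p_pred = Prim Zero (Proj 1)"
definition "p_sub = Comp (Prim (Proj 0) (Comp p_pred [Proj 0])) [Proj 1, Proj 0]"
text \<open>The step of the recursion sees the previous value, the counter and the two alternatives,
  so \<open>Proj 3\<close> is the second alternative. Both alternatives are evaluated first; if one
  may diverge, \<open>p_if\<close> takes its place.\<close>

definition "p_cond = Prim (Proj 0) (Proj 3)"
definition "p_tri = Prim Zero (Comp p_add [Proj 0, Comp Succ [Proj 1]])"
definition "p_pair = Comp p_add [Comp p_tri [Comp p_add [Proj 0, Proj 1]], Proj 0]"
text \<open>For \<open>pair m n\<close>, which is \<open>triangle (m + n) + m\<close>, the least
  \<open>t\<close> with \<open>pair m n < triangle (Suc t)\<close> is \<open>m + n\<close>.
  Subtracting the triangular number gives \<open>m\<close>, and then \<open>n\<close>.\<close>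

definition "p_root = Mu (Comp p_sub [Comp Succ [Proj 1], Comp p_tri [Comp Succ [Proj 0]]])"
definition "p_fst = Comp p_sub [Proj 0, Comp p_tri [p_root]]"
definition "p_snd = Comp p_sub [p_root, p_fst]"

primrec p_const :: "nat \<Rightarrow> recf" where
  "p_const 0 = Zero"
| "p_const (Suc n) = Comp Succ [p_const n]"

abbreviation pair :: "nat \<Rightarrow> nat \<Rightarrow> nat" where "pair m n \<equiv> prod_encode (m, n)"
abbreviation pfst :: "nat \<Rightarrow> nat" where "pfst z \<equiv> fst (prod_decode z)"
abbreviation psnd :: "nat \<Rightarrow> nat" where "psnd z \<equiv> snd (prod_decode z)"

lemma eval_add [simp]: "eval f p_add [m, n] y \<longleftrightarrow> y = m + n"
  by (rule eval_iff) (induction m; simp add: p_add_def)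

lemma eval_pred [simp]: "eval f p_pred [n] y \<longleftrightarrow> y = n - 1"
  by (rule eval_iff) (induction n; auto simp: p_pred_def)

lemma eval_sub [simp]: "eval f p_sub [m, n] y \<longleftrightarrow> y = m - n"
proof (rule eval_iff)
  have "eval f (Prim (Proj 0) (Comp p_pred [Proj 0])) [n, m] (m - n)"
    by (induction n) auto
  then show "eval f p_sub [m, n] (m - n)" by (simp add: p_sub_def)
qed

lemma eval_cond [simp]: "eval f p_cond [z, a, b] y \<longleftrightarrow> y = (if z = 0 then a else b)"
proof (rule eval_iff)
  show "eval f p_cond [z, a, b] (if z = 0 then a else b)"
    by (induction z) (auto simp: p_cond_def)
qed

lemma eval_tri [simp]: "eval f p_tri [n] y \<longleftrightarrow> y = triangle n"
  by (rule eval_iff) (induction n; simp add: p_tri_def)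

lemma eval_const [simp]: "eval f (p_const n) xs y \<longleftrightarrow> y = n"
  by (induction n arbitrary: y) auto

lemma eval_pair [simp]: "eval f p_pair [m, n] y \<longleftrightarrow> y = pair m n"
  by (simp add: p_pair_def prod_encode_def)

lemma triangle_mono: "m \<le> n \<Longrightarrow> triangle m \<le> triangle n"
  by (rule lift_Suc_mono_le[of triangle]) auto

lemma eval_root [simp]: "eval f p_root [pair m n] y \<longleftrightarrow> y = m + n"
proof (rule eval_iff)
  let ?p = "Comp p_sub [Comp Succ [Proj 1], Comp p_tri [Comp Succ [Proj 0]]]"
  have "\<exists>y. eval f ?p [t, pair m n] (Suc y)" if "t < m + n" for t
    using triangle_mono[of "Suc t" "m + n"] that by (simp add: prod_encode_def del: triangle_Suc) presburger
  moreover have "eval f ?p [m + n, pair m n] 0"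
    by (simp add: prod_encode_def)
  ultimately show "eval f p_root [pair m n] (m + n)"
    unfolding p_root_def by (auto intro!: mu simp del: eval_Comp_2)
qed

lemma pair_cases: obtains m n where "z = pair m n"
  by (metis prod_decode_inverse surj_pair)

lemma eval_fst [simp]: "eval f p_fst [z] y \<longleftrightarrow> y = pfst z"
  by (rule pair_cases[of z]) (simp add: p_fst_def, simp add: prod_encode_def)

lemma eval_snd [simp]: "eval f p_snd [z] y \<longleftrightarrow> y = psnd z"
  by (rule pair_cases[of z]) (simp add: p_snd_def)

text \<open>The base of the recursion is harmless, so \<^term>\<open>p\<close> is run only if the first argument is 1.\<close>

definition "p_when p = Prim Zero (Comp p [Proj 2, Proj 3])"

lemma eval_when [simp]:
  "eval f (p_when p) [0, x, y] z \<longleftrightarrow> z = 0"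
  "eval f (p_when p) [Suc 0, x, y] z \<longleftrightarrow> eval f p [x, y] z"
  by (simp_all add: p_when_def)

text \<open>Exactly one of the two flags is 1. The other program is never started and contributes 0,
  so it may diverge.\<close>

definition "p_if p q = Comp p_add [Comp (p_when p) [Comp p_sub [p_const 1, Proj 0], Proj 1, Proj 2],
    Comp (p_when q) [Comp p_cond [Proj 0, p_const 0, p_const 1], Proj 1, Proj 2]]"

lemma eval_if [simp]:
  "eval f (p_if p q) [b, x, y] z \<longleftrightarrow> eval f (if b = 0 then p else q) [x, y] z"
  by (cases b) (auto simp: p_if_def)

lemma list_all2_Proj:
  "xs = us @ vs \<Longrightarrow> i = length us \<Longrightarrow> j = length xs \<Longrightarrow>
    list_all2 (\<lambda>p y. eval f p xs y) (map Proj [i..<j]) vs"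
  by (auto simp: list_all2_conv_all_nth nth_append)

subsection \<open>Substitution for the oracle\<close>

text \<open>\<^term>\<open>k\<close> is the number of arguments of the program. The oracle may depend on a parameter,
  which is passed on as an additional last argument.\<close>

primrec osub :: "recf \<Rightarrow> recf \<Rightarrow> nat \<Rightarrow> recf" where
  "osub q Zero k = Zero"
| "osub q Succ k = Comp Succ [Proj 0]"
| "osub q (Proj i) k = Proj i"
| "osub q Oracle k = q"
| "osub q (Comp r ps) k = Comp (osub q r (length ps)) (map (\<lambda>p. osub q p k) ps @ [Proj k])"
| "osub q (Prim p r) k = Prim (osub q p (k - 1)) (osub q r (Suc k))"
| "osub q (Mu p) k = Mu (osub q p (Suc k))"

text \<open>The parameter stands last because \<open>Prim\<close> and \<open>Mu\<close> add and
  remove arguments at the front only. \<open>Succ\<close> needs the detour through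
  \<open>Proj 0\<close>, having no value on longer argument lists.\<close>

lemma eval_osub:
  assumes q: "\<And>n. eval f q [n, a] (g n)"
  shows "eval g p xs y \<Longrightarrow> eval f (osub q p (length xs)) (xs @ [a]) y"
proof (induction rule: eval.induct)
  case (comp xs ps ys r z)
  have "length ps = length ys"
    using comp.IH(1) by (rule list_all2_lengthD)
  moreover have "list_all2 (\<lambda>p y. eval f p (xs @ [a]) y) (map (\<lambda>p. osub q p (length xs)) ps) ys"
    using comp.IH(1) by (auto simp: list_all2_conv_all_nth)
  then have "list_all2 (\<lambda>p y. eval f p (xs @ [a]) y)
      (map (\<lambda>p. osub q p (length xs)) ps @ [Proj (length xs)]) (ys @ [a])"
    by (auto intro: list_all2_appendI)
  ultimately show ?case
    using comp.IH(2) by (auto simp: eval_Comp)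
next
  case (mu p n xs)
  then show ?case by (auto intro!: eval.mu)
next
  case (prim_Suc p r n xs y z)
  then show ?case by auto
qed (auto simp: q nth_append)

lemma eval_osub_1:
  assumes "\<And>n. eval f q [n, a] (g n)" "eval g p [x] y"
  shows "eval f (osub q p 1) [x, a] y"
  using eval_osub[of f q a g p "[x]" y] assms by simp

text \<open>Plain composition of functionals: the parameter is the dummy 0, and
  \<open>Proj 0\<close> hides it from \<open>q\<close>.\<close>

definition "p_relative q p = Comp (osub (Comp q [Proj 0]) p 1) [Proj 0, Zero]"

lemma eval_relative:
  assumes "\<And>n. eval f q [n] (g n)" "eval g p [x] y"
  shows "eval f (p_relative q p) [x] y"
  using eval_osub_1[of f "Comp q [Proj 0]" 0 g p x y] assms by (simp add: p_relative_def)


subsection \<open>Bounded approximation of computations\<close>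

text \<open>\<^term>\<open>bval L s p xs\<close> runs \<^term>\<open>p\<close> on a partial oracle: \<open>0\<close> stands for
  ``undefined'' and \<^term>\<open>Suc y\<close> for the value \<^term>\<open>y\<close>, both in \<^term>\<open>L\<close> and in the result.
  Minimisations are cut off at \<^term>\<open>s\<close>, which makes the function total. In the recursion for
  \<^const>\<open>Mu\<close>, the state \<open>1\<close> means that the search goes on.\<close>

fun bval :: "(nat \<Rightarrow> nat) \<Rightarrow> nat \<Rightarrow> recf \<Rightarrow> nat list \<Rightarrow> nat" where
  "bval L s Zero xs = 1"
| "bval L s Succ xs = (case xs of [x] \<Rightarrow> Suc (Suc x) | _ \<Rightarrow> 0)"
| "bval L s (Proj i) xs = (if i < length xs then Suc (xs ! i) else 0)"
| "bval L s Oracle xs = (case xs of [x] \<Rightarrow> L x | _ \<Rightarrow> 0)"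
| "bval L s (Comp q ps) xs =
    (if \<exists>p\<in>set ps. bval L s p xs = 0 then 0
     else bval L s q (map (\<lambda>p. bval L s p xs - 1) ps))"
| "bval L s (Prim p q) xs = (case xs of [] \<Rightarrow> 0 | n # ys \<Rightarrow>
    rec_nat (bval L s p ys) (\<lambda>m r. if r = 0 then 0 else bval L s q ((r - 1) # m # ys)) n)"
| "bval L s (Mu p) xs =
    rec_nat 1 (\<lambda>m r. if r = 0 then 0 else if r - 1 = 0 then
        (if bval L s p (m # xs) = 0 then 0 else if bval L s p (m # xs) - 1 = 0 then Suc (Suc m) else 1)
      else r) s - 1"

text \<open>Two claims are carried through the induction: no stage gives a wrong value, and almost
  all stages give the right one. Together they make the first defined stage exist and be correct,
  which is what an associate requires.\<close>

lemma bval_approximates: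
  assumes L: "\<And>s x. L s x = 0 \<or> L s x = Suc (g x)"
    and ev: "\<And>x. eventually (\<lambda>s. L s x = Suc (g x)) sequentially"
  shows "eval g p xs y \<Longrightarrow>
    (\<forall>s. bval (L s) s p xs = 0 \<or> bval (L s) s p xs = Suc y) \<and>
    eventually (\<lambda>s. bval (L s) s p xs = Suc y) sequentially"
proof (induction rule: eval.induct)
  case (query x)
  then show ?case using L ev by auto
next
  case (comp xs ps ys q z)
  have len: "length ps = length ys"
    using comp.IH(1) by (rule list_all2_lengthD)
  have IH: "bval (L s) s (ps ! i) xs = 0 \<or> bval (L s) s (ps ! i) xs = Suc (ys ! i)"
    "eventually (\<lambda>s. bval (L s) s (ps ! i) xs = Suc (ys ! i)) sequentially"
    if "i < length ps" for i s
    using comp.IH(1) that by (auto simp: list_all2_conv_all_nth)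
  have map_eq: "map (\<lambda>p. bval (L s) s p xs - 1) ps = ys" if "\<forall>p\<in>set ps. bval (L s) s p xs \<noteq> 0" for s
  proof (rule nth_equalityI)
    fix i
    assume "i < length (map (\<lambda>p. bval (L s) s p xs - 1) ps)"
    then show "map (\<lambda>p. bval (L s) s p xs - 1) ps ! i = ys ! i"
      using IH(1)[of i s] that by auto
  qed (simp add: len)
  have "eventually (\<lambda>s. \<forall>i\<in>{..<length ps}. bval (L s) s (ps ! i) xs = Suc (ys ! i)) sequentially"
    by (rule eventually_ball_finite) (use IH(2) in auto)
  then have "eventually (\<lambda>s. \<forall>p\<in>set ps. bval (L s) s p xs \<noteq> 0) sequentially"
    by (rule eventually_mono) (metis in_set_conv_nth lessThan_iff nat.distinct(1))
  moreover have "eventually (\<lambda>s. bval (L s) s q ys = Suc z) sequentially"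
    using comp.IH(2) by blast
  ultimately have "eventually (\<lambda>s. bval (L s) s (Comp q ps) xs = Suc z) sequentially"
  proof eventually_elim
    case (elim s)
    then show ?case using map_eq[of s] by (simp del: One_nat_def)
  qed
  then show ?case using comp.IH(2) map_eq by (auto simp del: One_nat_def)
next
  case (prim_Suc p q n xs y z)
  have step: "bval (L s) s (Prim p q) (Suc n # xs) =
      (if bval (L s) s (Prim p q) (n # xs) = 0 then 0
       else bval (L s) s q ((bval (L s) s (Prim p q) (n # xs) - 1) # n # xs))" for s
    by simp
  have "eventually (\<lambda>s. bval (L s) s (Prim p q) (Suc n # xs) = Suc z) sequentially"
    using prim_Suc.IH(1)[THEN conjunct2] prim_Suc.IH(2)[THEN conjunct2]
    unfolding step by eventually_elim simp
  moreover have "bval (L s) s (Prim p q) (Suc n # xs) = 0 \<or> bval (L s) s (Prim p q) (Suc n # xs) = Suc z" for s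
    using prim_Suc.IH(1)[THEN conjunct1, THEN spec[of _ s]] prim_Suc.IH(2)[THEN conjunct1, THEN spec[of _ s]]
    unfolding step by auto
  ultimately show ?case by blast
next
  case (mu p n xs)
  \<comment> \<open>State 0 is undefined, 1 is still searching, \<open>Suc (Suc m)\<close> has found
    \<open>m\<close>. The final \<open>- 1\<close> turns a search that was cut off into an undefined
    result.\<close>
  define st where "st s = rec_nat 1 (\<lambda>m r. if r = 0 then 0 else if r - 1 = 0 then
        (if bval (L s) s p (m # xs) = 0 then 0 else if bval (L s) s p (m # xs) - 1 = 0 then Suc (Suc m) else 1)
      else r)" for s
  have st: "st s 0 = 1" "st s (Suc m) = (if st s m = 0 then 0 else if st s m - 1 = 0 then
        (if bval (L s) s p (m # xs) = 0 then 0 else if bval (L s) s p (m # xs) - 1 = 0 then Suc (Suc m) else 1)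
      else st s m)" for s m
    by (simp_all add: st_def)
  have val: "bval (L s) s (Mu p) xs = st s s - 1" for s
    by (simp add: st_def)
  obtain v where v: "\<And>m. m < n \<Longrightarrow> (\<forall>s. bval (L s) s p (m # xs) = 0 \<or> bval (L s) s p (m # xs) = Suc (Suc (v m)))
      \<and> eventually (\<lambda>s. bval (L s) s p (m # xs) = Suc (Suc (v m))) sequentially"
  proof -
    have "\<forall>m\<in>{..<n}. \<exists>y. (\<forall>s. bval (L s) s p (m # xs) = 0 \<or> bval (L s) s p (m # xs) = Suc (Suc y))
        \<and> eventually (\<lambda>s. bval (L s) s p (m # xs) = Suc (Suc y)) sequentially"
      using mu.IH(2) by blast
    from bchoice[OF this] show ?thesis
      using that by auto
  qed
  \<comment> \<open>The tests below \<open>n\<close> never give 0, so nothing is found before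
    \<open>n\<close> is tested; afterwards the state is frozen at the answer \<open>n\<close> or at
    undefined.\<close>
  have before: "st s m \<le> 1" if "m \<le> n" for s m
    using that
  proof (induction m)
    case (Suc m)
    have "bval (L s) s p (m # xs) = 0 \<or> bval (L s) s p (m # xs) = Suc (Suc (v m))"
      using v[of m] Suc.prems by simp
    then show ?case using Suc by (auto simp: st(2))
  qed (simp add: st)
  have after: "st s m = 0 \<or> st s m = Suc (Suc n)" if "m > n" for s m
    using that
  proof (induction m)
    case (Suc m)
    show ?case
    proof (cases "m = n")
      case True
      have "bval (L s) s p (n # xs) = 0 \<or> bval (L s) s p (n # xs) = Suc 0"
        using mu.IH(1) by simp
      then show ?thesis using True before[of n s] by (auto simp: st(2))
    next
      case False
      then show ?thesis using Suc by (auto simp: st(2))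
    qed
  qed simp
  have "st s s - 1 = 0 \<or> st s s - 1 = Suc n" for s
    using before[of s s] after[of s s] by (cases "s \<le> n") auto
  moreover have "eventually (\<lambda>s. \<forall>m\<in>{..<n}. bval (L s) s p (m # xs) = Suc (Suc (v m))) sequentially"
    by (rule eventually_ball_finite) (use v in auto)
  \<comment> \<open>Besides the convergence of the finitely many tests, the cut-off \<open>s\<close>
    must exceed \<open>n\<close> for \<open>n\<close> to be tested at all.\<close>
  then have "eventually (\<lambda>s. st s s - 1 = Suc n) sequentially"
    using mu.IH(1)[THEN conjunct2] eventually_gt_at_top[of n]
  proof eventually_elim
    case (elim s)
    have "st s m = 1" if "m \<le> n" for m
      using that by (induction m) (use elim in \<open>auto simp: st\<close>)
    then have "st s (Suc n) = Suc (Suc n)"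
      using elim by (simp add: st(2))
    then have "st s (Suc n + k) = Suc (Suc n)" for k
      by (induction k) (simp_all add: st(2))
    from this[of "s - Suc n"] show ?case using elim by simp
  qed
  ultimately show ?case unfolding val by blast
qed auto

text \<open>For a fixed \<open>p\<close> the approximation is built from \<open>l\<close> by
  composition and bounded recursion, so induction on \<open>p\<close> writes down a program for it.
  The arity \<open>k\<close> is fixed in advance because the program must know at which position
  \<open>\<sigma>\<close> stands; \<open>\<sigma>\<close> carries the cut-off in its first
  component.\<close>

lemma bval_program:
  assumes l: "\<And>f x \<sigma>. eval f l [x, \<sigma>] (L f \<sigma> x)"
  shows "\<exists>r. \<forall>f \<sigma> xs. length xs = k \<longrightarrow> eval f r (xs @ [\<sigma>]) (bval (L f \<sigma>) (pfst \<sigma>) p xs)"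
proof (induction p arbitrary: k)
  case Zero
  show ?case by (rule exI[of _ "p_const 1"]) simp
next
  case Succ
  show ?case
    by (rule exI[of _ "if k = 1 then Comp Succ [Comp Succ [Proj 0]] else p_const 0"])
      (auto simp: length_Suc_conv split: list.split)
next
  case (Proj i)
  show ?case
    by (rule exI[of _ "if i < k then Comp Succ [Proj i] else p_const 0"]) (auto simp: nth_append)
next
  case Oracle
  show ?case
    by (rule exI[of _ "if k = 1 then l else p_const 0"])
      (auto simp: length_Suc_conv l split: list.split)
next
  case (Comp q ps)
  let ?v = "\<lambda>f \<sigma>. bval (L f \<sigma>) (pfst \<sigma>)"
  obtain R where R: "\<And>p f \<sigma> xs. p \<in> set ps \<Longrightarrow> length xs = k \<Longrightarrow> eval f (R p) (xs @ [\<sigma>]) (?v f \<sigma> p xs)"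
    using Comp(2)[of _ k] by metis
  obtain r where r: "\<And>f \<sigma> xs. length xs = length ps \<Longrightarrow> eval f r (xs @ [\<sigma>]) (?v f \<sigma> q xs)"
    using Comp(1) by metis
  \<comment> \<open>The program \<open>t\<close> tests whether all arguments of the composition are
    defined.\<close>
  have "\<exists>t. \<forall>f \<sigma> xs. length xs = k \<longrightarrow>
      eval f t (xs @ [\<sigma>]) (if \<exists>p\<in>set ps'. ?v f \<sigma> p xs = 0 then 0 else 1)" if "set ps' \<subseteq> set ps" for ps'
    using that
  proof (induction ps')
    case Nil
    show ?case by (rule exI[of _ "p_const 1"]) simp
  next
    case (Cons p ps')
    then obtain t where t: "\<And>f \<sigma> xs. length xs = k \<Longrightarrow>
        eval f t (xs @ [\<sigma>]) (if \<exists>p\<in>set ps'. ?v f \<sigma> p xs = 0 then 0 else 1)" by auto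
    have "eval f (Comp p_cond [R p, p_const 0, t]) (xs @ [\<sigma>])
        (if \<exists>p\<in>set (p # ps'). ?v f \<sigma> p xs = 0 then 0 else 1)" if "length xs = k" for f \<sigma> xs
    proof -
      have "eval f (R p) (xs @ [\<sigma>]) (?v f \<sigma> p xs)"
        using R that Cons.prems by simp
      note eval_iff[OF this] eval_iff[OF t[OF that, of f \<sigma>]]
      then show ?thesis by simp
    qed
    then show ?case by blast
  qed
  then obtain t where t: "\<And>f \<sigma> xs. length xs = k \<Longrightarrow>
      eval f t (xs @ [\<sigma>]) (if \<exists>p\<in>set ps. ?v f \<sigma> p xs = 0 then 0 else 1)" by blast
  \<comment> \<open>The strict \<open>p_cond\<close> suffices, since \<open>bval\<close> is total:
    an undefined argument is replaced by 0 through the predecessor, and \<open>t\<close> discards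
    the outcome.\<close>
  let ?r = "Comp p_cond [t, p_const 0, Comp r (map (\<lambda>p. Comp p_pred [R p]) ps @ [Proj k])]"
  have "eval f ?r (xs @ [\<sigma>]) (?v f \<sigma> (Comp q ps) xs)" if len: "length xs = k" for f \<sigma> xs
  proof -
    have "list_all2 (\<lambda>p y. eval f p (xs @ [\<sigma>]) y) (map (\<lambda>p. Comp p_pred [R p]) ps @ [Proj k])
        (map (\<lambda>p. ?v f \<sigma> p xs - 1) ps @ [\<sigma>])"
      using R len by (intro list_all2_appendI) (force simp: list_all2_conv_all_nth nth_append)+
    then have "eval f (Comp r (map (\<lambda>p. Comp p_pred [R p]) ps @ [Proj k])) (xs @ [\<sigma>])
        (?v f \<sigma> q (map (\<lambda>p. ?v f \<sigma> p xs - 1) ps))"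
      by (rule eval.comp) (simp add: r)
    note eval_iff[OF this] eval_iff[OF t[OF len, of f \<sigma>]]
    then show ?thesis by auto
  qed
  then show ?case by blast
next
  case (Prim p q)
  show ?case
  proof (cases k)
    case 0
    then show ?thesis by (intro exI[of _ "p_const 0"]) auto
  next
    case (Suc k')
    let ?v = "\<lambda>f \<sigma>. bval (L f \<sigma>) (pfst \<sigma>)"
    obtain rp where rp: "\<And>f \<sigma> xs. length xs = k' \<Longrightarrow> eval f rp (xs @ [\<sigma>]) (?v f \<sigma> p xs)"
      using Prim(1) by metis
    obtain rq where rq: "\<And>f \<sigma> xs. length xs = Suc k \<Longrightarrow> eval f rq (xs @ [\<sigma>]) (?v f \<sigma> q xs)"
      using Prim(2) by metis
    \<comment> \<open>The step sees \<open>h m # m # ys @ [\<sigma>]\<close>, a list of length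
      \<open>k + 2\<close>; the projections from 1 on pass everything after the running
      value.\<close>
    let ?s = "Comp p_cond [Proj 0, p_const 0, Comp rq (Comp p_pred [Proj 0] # map Proj [1..<k + 2])]"
    have "eval f (Prim rp ?s) (xs @ [\<sigma>]) (?v f \<sigma> (Prim p q) xs)" if len: "length xs = k" for f \<sigma> xs
    proof -
      obtain n ys where xs: "xs = n # ys" "length ys = k'"
        using len Suc by (cases xs) auto
      define h where "h = rec_nat (?v f \<sigma> p ys) (\<lambda>m r. if r = 0 then 0 else ?v f \<sigma> q ((r - 1) # m # ys))"
      have "eval f (Prim rp ?s) (n # (ys @ [\<sigma>])) (h n)"
      proof (rule eval_PrimI)
        show "eval f rp (ys @ [\<sigma>]) (h 0)"
          using rp xs by (simp add: h_def)
      next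
        fix m
        have "list_all2 (\<lambda>p y. eval f p (h m # m # ys @ [\<sigma>]) y) (map Proj [1..<k + 2]) (m # ys @ [\<sigma>])"
          by (rule list_all2_Proj[of _ "[h m]"]) (use xs Suc in auto)
        then have "eval f (Comp rq (Comp p_pred [Proj 0] # map Proj [1..<k + 2])) (h m # m # ys @ [\<sigma>])
            (?v f \<sigma> q ((h m - 1) # m # ys))"
          using rq[of "(h m - 1) # m # ys" f \<sigma>] xs Suc
          by (intro eval.comp[where ys = "(h m - 1) # m # ys @ [\<sigma>]"]) auto
        then show "eval f ?s (h m # m # ys @ [\<sigma>]) (h (Suc m))"
          by (auto simp: h_def)
      qed
      then show ?thesis by (simp add: xs h_def)
    qed
    then show ?thesis by blast
  qed
next
  case (Mu p)
  let ?v = "\<lambda>f \<sigma>. bval (L f \<sigma>) (pfst \<sigma>)"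
  obtain r where r: "\<And>f \<sigma> xs. length xs = Suc k \<Longrightarrow> eval f r (xs @ [\<sigma>]) (?v f \<sigma> p xs)"
    using Mu by metis
  define t where "t = Comp r (map Proj [1..<k + 3])"
  let ?s = "Comp p_cond [Proj 0, p_const 0, Comp p_cond [Comp p_pred [Proj 0],
      Comp p_cond [t, p_const 0, Comp p_cond [Comp p_pred [t], Comp Succ [Comp Succ [Proj 1]], p_const 1]],
      Proj 0]]"
  have "eval f (Comp p_pred [Comp (Prim (p_const 1) ?s) (Comp p_fst [Proj k] # map Proj [0..<k + 1])])
      (xs @ [\<sigma>]) (?v f \<sigma> (Mu p) xs)" if len: "length xs = k" for f \<sigma> xs
  proof -
    define h where "h = rec_nat 1 (\<lambda>m r. if r = 0 then 0 else if r - 1 = 0 then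
        (if ?v f \<sigma> p (m # xs) = 0 then 0 else if ?v f \<sigma> p (m # xs) - 1 = 0 then Suc (Suc m) else 1)
      else r)"
    have "eval f (Prim (p_const 1) ?s) (pfst \<sigma> # (xs @ [\<sigma>])) (h (pfst \<sigma>))"
    proof (rule eval_PrimI)
      fix m
      have "list_all2 (\<lambda>p y. eval f p (h m # m # xs @ [\<sigma>]) y) (map Proj [1..<k + 3]) (m # xs @ [\<sigma>])"
        by (rule list_all2_Proj[of _ "[h m]"]) (use len in auto)
      then have "eval f t (h m # m # xs @ [\<sigma>]) (?v f \<sigma> p (m # xs))"
        unfolding t_def by (rule eval.comp) (use r[of "m # xs" f \<sigma>] len in simp)
      note t = eval_iff[OF this]
      have "h (Suc m) = (if h m = 0 then 0 else if h m - 1 = 0 then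
          (if ?v f \<sigma> p (m # xs) = 0 then 0 else if ?v f \<sigma> p (m # xs) - 1 = 0 then Suc (Suc m) else 1)
        else h m)"
        by (simp add: h_def)
      then show "eval f ?s (h m # m # xs @ [\<sigma>]) (h (Suc m))"
        by (simp add: t)
    qed (simp add: h_def)
    moreover have "list_all2 (\<lambda>p y. eval f p (xs @ [\<sigma>]) y) (Comp p_fst [Proj k] # map Proj [0..<k + 1])
        (pfst \<sigma> # (xs @ [\<sigma>]))"
      using list_all2_Proj[of "xs @ [\<sigma>]" "[]" "xs @ [\<sigma>]" 0 "k + 1" f] len
      by (simp del: upt_Suc add: nth_append)
    ultimately have "eval f (Comp (Prim (p_const 1) ?s) (Comp p_fst [Proj k] # map Proj [0..<k + 1]))
        (xs @ [\<sigma>]) (h (pfst \<sigma>))"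
      by (intro eval.comp)
    moreover have "?v f \<sigma> (Mu p) xs = h (pfst \<sigma>) - 1"
      by (simp add: h_def)
    ultimately show ?thesis
      by (subst eval_Comp_1) auto
  qed
  then show ?case by blast
qed

section \<open>Uniform reducibility of families of mass problems\<close>

definition fam_le :: "nat set \<Rightarrow> (nat \<Rightarrow> mass_problem) \<Rightarrow> (nat \<Rightarrow> mass_problem) \<Rightarrow> bool" where
  "fam_le X A B \<longleftrightarrow>
     (\<exists>p. \<forall>i\<in>X. \<forall>g\<in>B i. \<exists>f\<in>A i. \<forall>n. eval (case_nat i g) p [n] (f n))"

definition "p_head = Comp Oracle [Zero]"
definition "p_tail = Comp Oracle [Succ]"
text \<open>The recursion serves as a case distinction: \<open>h\<close> runs on the empty list at
  place 0, and the step looks only at the counter.\<close>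

definition "p_cons h t = Prim h (Comp t [Proj 1])"

lemma eval_head [simp]: "eval f p_head xs y \<longleftrightarrow> y = f 0"
  by (simp add: p_head_def)

lemma eval_tail [simp]: "eval f p_tail [n] y \<longleftrightarrow> y = f (Suc n)"
  by (simp add: p_tail_def)

lemma eval_cons:
  assumes "eval f h [] a" "\<And>n. eval f t [n] (b n)"
  shows "eval f (p_cons h t) [n] (case_nat a b n)"
proof (induction n)
  case (Suc n)
  then show ?case unfolding p_cons_def using assms(2)[of n] by auto
qed (simp add: p_cons_def assms)

lemma fam_leI:
  "(\<And>i g. i \<in> X \<Longrightarrow> g \<in> B i \<Longrightarrow> \<exists>f\<in>A i. \<forall>n. eval (case_nat i g) p [n] (f n)) \<Longrightarrow> fam_le X A B"
  unfolding fam_le_def by blast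

lemma fam_leE:
  assumes "fam_le X A B"
  obtains p F where "\<And>i g. i \<in> X \<Longrightarrow> g \<in> B i \<Longrightarrow> F i g \<in> A i"
    "\<And>i g n. i \<in> X \<Longrightarrow> g \<in> B i \<Longrightarrow> eval (case_nat i g) p [n] (F i g n)"
proof -
  from assms obtain p where "\<forall>i\<in>X. \<forall>g\<in>B i. \<exists>f. f \<in> A i \<and> (\<forall>n. eval (case_nat i g) p [n] (f n))"
    unfolding fam_le_def by blast
  then show ?thesis using that[of _ p] by metis
qed

text \<open>This is the form in which given reductions are reused: \<open>h\<close> and
  \<open>t\<close> compute a new index and a new oracle from the old ones, and the given program
  runs on their concatenation.\<close>

lemma fam_le_subst:
  assumes le: "fam_le X A B"
    and *: "\<And>i g. i \<in> Y \<Longrightarrow> g \<in> B' i \<Longrightarrow> \<exists>j\<in>X. \<exists>g'\<in>B j. A j \<subseteq> A' i \<and>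
      eval (case_nat i g) h [] j \<and> (\<forall>n. eval (case_nat i g) t [n] (g' n))"
  shows "fam_le Y A' B'"
proof -
  obtain p F where F: "\<And>i g. i \<in> X \<Longrightarrow> g \<in> B i \<Longrightarrow> F i g \<in> A i"
    "\<And>i g n. i \<in> X \<Longrightarrow> g \<in> B i \<Longrightarrow> eval (case_nat i g) p [n] (F i g n)"
    using le by (rule fam_leE) blast
  show ?thesis
  proof (rule fam_leI[where p = "p_relative (p_cons h t) p"])
    fix i g
    assume "i \<in> Y" "g \<in> B' i"
    then obtain j g' where j: "j \<in> X" "g' \<in> B j" "A j \<subseteq> A' i"
      and e: "eval (case_nat i g) h [] j" "\<And>n. eval (case_nat i g) t [n] (g' n)"
      using * by blast
    have "eval (case_nat i g) (p_relative (p_cons h t) p) [n] (F j g' n)" for n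
      by (rule eval_relative[OF eval_cons[OF e]]) (rule F(2)[OF j(1,2)])
    then show "\<exists>f\<in>A' i. \<forall>n. eval (case_nat i g) (p_relative (p_cons h t) p) [n] (f n)"
      using F(1)[OF j(1,2)] j(3) by blast
  qed
qed

lemma fam_le_refl: "fam_le X A A"
  by (rule fam_leI[where p = p_tail]) auto

lemma fam_le_trans:
  assumes "fam_le X A B" "fam_le X B C"
  shows "fam_le X A C"
proof -
  obtain q G where "\<And>i g. i \<in> X \<Longrightarrow> g \<in> C i \<Longrightarrow> G i g \<in> B i"
    "\<And>i g n. i \<in> X \<Longrightarrow> g \<in> C i \<Longrightarrow> eval (case_nat i g) q [n] (G i g n)"
    using assms(2) by (rule fam_leE) blast
  then show ?thesis
    by (intro fam_le_subst[OF assms(1), where h = p_head and t = q]) (auto simp: Bex_def, blast)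
qed

text \<open>Where \<open>B' i\<close> is empty there is nothing to reduce, so the inclusion of
  \<open>A i\<close> is asked only elsewhere. Equality relies on this off the diagonal.\<close>

lemma fam_le_mono:
  assumes "fam_le X A B" "\<And>i. i \<in> X \<Longrightarrow> B' i \<subseteq> B i" "\<And>i. i \<in> X \<Longrightarrow> B' i \<noteq> {} \<Longrightarrow> A i \<subseteq> A' i"
  shows "fam_le X A' B'"
  by (rule fam_le_subst[OF assms(1), where h = p_head and t = p_tail]) (use assms(2,3) in force)

lemma fam_le_subset: "(\<And>i. i \<in> X \<Longrightarrow> B i \<subseteq> A i) \<Longrightarrow> fam_le X A B"
  by (rule fam_le_mono[OF fam_le_refl]) auto

section \<open>Computable functions between index sets, and finite index sets\<close>

definition computable_on2 :: "nat set \<Rightarrow> nat set \<Rightarrow> (nat \<Rightarrow> nat \<Rightarrow> nat) \<Rightarrow> bool" where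
  "computable_on2 X Y h \<longleftrightarrow> (\<exists>p. \<forall>i\<in>X. \<forall>j\<in>Y. \<forall>f. eval f p [i, j] (h i j))"

text \<open>The program is known to work with the zero oracle only; substituting \<open>Zero\<close>
  for the oracle makes it correct inside reductions, under every oracle.\<close>

lemma computable_onE:
  assumes "computable_on X \<alpha>"
  obtains p where "\<And>i f. i \<in> X \<Longrightarrow> eval f p [i] (\<alpha> i)"
proof -
  obtain p where p: "\<And>i. i \<in> X \<Longrightarrow> eval (\<lambda>_. 0) p [i] (\<alpha> i)"
    using assms unfolding computable_on_def by blast
  show ?thesis
    by (rule that[of "p_relative Zero p"]) (rule eval_relative[where g = "\<lambda>_. 0"], simp, erule p)
qed

lemma computable_onI: "(\<And>i. i \<in> X \<Longrightarrow> eval (\<lambda>_. 0) p [i] (\<alpha> i)) \<Longrightarrow> computable_on X \<alpha>"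
  unfolding computable_on_def by blast

lemma fam_le_reindex:
  assumes "fam_le Y A B" "computable_on X \<alpha>" "\<And>i. i \<in> X \<Longrightarrow> \<alpha> i \<in> Y"
  shows "fam_le X (\<lambda>i. A (\<alpha> i)) (\<lambda>i. B (\<alpha> i))"
proof -
  obtain a where "\<And>i f. i \<in> X \<Longrightarrow> eval f a [i] (\<alpha> i)"
    using assms(2) by (rule computable_onE) blast
  then show ?thesis
    by (intro fam_le_subst[OF assms(1), where h = "Comp a [p_head]" and t = p_tail])
      (use assms(3) in force)
qed

text \<open>Finitely many programs are wired in by case distinction: \<open>?d\<close> is the
  distance of \<open>i\<close> and \<open>j\<close>, zero exactly at \<open>j\<close>. The branches
  go through \<open>p_if\<close> because a program chosen for another index may diverge
  here.\<close>

lemma finite_choice_program: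
  assumes "finite X" "\<And>i. i \<in> X \<Longrightarrow> \<exists>p. \<forall>n f. S i f \<longrightarrow> eval f p [n] (F i f n)"
  shows "\<exists>p. \<forall>i\<in>X. \<forall>n f. S i f \<longrightarrow> eval f p [i, n] (F i f n)"
  using assms
proof (induction X rule: finite_induct)
  case (insert j X)
  obtain p where p: "\<forall>i\<in>X. \<forall>n f. S i f \<longrightarrow> eval f p [i, n] (F i f n)"
    using insert by auto
  obtain q where q: "\<forall>n f. S j f \<longrightarrow> eval f q [n] (F j f n)"
    using insert.prems by blast
  let ?d = "Comp p_add [Comp p_sub [Proj 0, p_const j], Comp p_sub [p_const j, Proj 0]]"
  have "eval f (Comp (p_if (Comp q [Proj 1]) p) [?d, Proj 0, Proj 1]) [i, n] (F i f n)"
    if "i \<in> insert j X" "S i f" for i n f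
    using that p q by (cases "i = j") auto
  then show ?case by blast
qed auto

lemma finite_computable_on:
  assumes "finite X"
  shows "computable_on X \<alpha>"
proof -
  obtain p where p: "\<forall>i\<in>X. \<forall>n f. eval f p [i, n] (\<alpha> i)"
    using finite_choice_program[OF assms, of "\<lambda>_ _. True" "\<lambda>i f n. \<alpha> i"]
    by (metis eval_const)
  show ?thesis
    by (rule computable_onI[where p = "Comp p [Proj 0, Proj 0]"]) (use p in auto)
qed

subsection \<open>The two orders of the hyperdoctrine are uniform reducibility\<close>

text \<open>Programs are deterministic, so each one determines a functional, and quantifying over
  functionals amounts to quantifying over programs. The index set \<open>I\<close> makes the lemma
  serve both orders.\<close>

lemma turing_functional_maps:
  "(\<exists>\<Phi>. turing_functional \<Phi> \<and> (\<forall>i\<in>I. maps_into \<Phi> (B i) (A i))) \<longleftrightarrow>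
    (\<exists>p. \<forall>i\<in>I. \<forall>g\<in>B i. \<exists>f\<in>A i. \<forall>n. eval g p [n] (f n))"
proof
  assume "\<exists>\<Phi>. turing_functional \<Phi> \<and> (\<forall>i\<in>I. maps_into \<Phi> (B i) (A i))"
  then show "\<exists>p. \<forall>i\<in>I. \<forall>g\<in>B i. \<exists>f\<in>A i. \<forall>n. eval g p [n] (f n)"
    unfolding turing_functional_def maps_into_def by metis
next
  assume "\<exists>p. \<forall>i\<in>I. \<forall>g\<in>B i. \<exists>f\<in>A i. \<forall>n. eval g p [n] (f n)"
  then obtain p where p: "\<forall>i\<in>I. \<forall>g\<in>B i. \<exists>f\<in>A i. \<forall>n. eval g p [n] (f n)" by blast
  define \<Phi> where "\<Phi> g = (if \<exists>f. \<forall>n. eval g p [n] (f n) then Some (SOME f. \<forall>n. eval g p [n] (f n)) else None)" for g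
  have \<Phi>: "\<Phi> g = Some f \<longleftrightarrow> (\<forall>n. eval g p [n] (f n))" for g f
  proof
    assume *: "\<Phi> g = Some f"
    then have "\<exists>f. \<forall>n. eval g p [n] (f n)"
      by (auto simp: \<Phi>_def split: if_splits)
    then have "\<forall>n. eval g p [n] ((SOME f. \<forall>n. eval g p [n] (f n)) n)"
      by (rule someI_ex)
    then show "\<forall>n. eval g p [n] (f n)"
      using * by (auto simp: \<Phi>_def split: if_splits)
  next
    assume *: "\<forall>n. eval g p [n] (f n)"
    then have "f' = f" if "\<forall>n. eval g p [n] (f' n)" for f'
      using that eval_deterministic by blast
    with * have "(SOME f. \<forall>n. eval g p [n] (f n)) = f"
      by (rule some_equality)
    then show "\<Phi> g = Some f"
      using * by (auto simp: \<Phi>_def)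
  qed
  then have "turing_functional \<Phi>"
    unfolding turing_functional_def by blast
  then show "\<exists>\<Phi>. turing_functional \<Phi> \<and> (\<forall>i\<in>I. maps_into \<Phi> (B i) (A i))"
    using p \<Phi> unfolding maps_into_def by metis
qed

lemma medvedev_le_iff:
  "medvedev_le A B \<longleftrightarrow> (\<exists>p. \<forall>g\<in>B. \<exists>f\<in>A. \<forall>n. eval g p [n] (f n))"
  using turing_functional_maps[of "{()}" "\<lambda>_. B" "\<lambda>_. A"] by (simp add: medvedev_le_def)

lemma medvedev_omega_le_iff: "medvedev_omega_le = fam_le UNIV"
proof (intro ext)
  show "medvedev_omega_le A B \<longleftrightarrow> fam_le UNIV A B" for A B
    using turing_functional_maps[of UNIV "\<lambda>n. prepend n (B n)" A]
    by (simp add: medvedev_omega_le_def fam_le_def prepend_def)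
qed

text \<open>A uniform program becomes one for \<open>i\<close> by prepending the constant
  \<open>i\<close> to its oracle. Conversely, the finitely many programs are joined by
  \<open>finite_choice_program\<close>.\<close>

lemma fam_le_finite_iff:
  assumes "finite X"
  shows "fam_le X A B \<longleftrightarrow> (\<forall>i\<in>X. medvedev_le (A i) (B i))"
proof
  assume "fam_le X A B"
  then obtain p F where F: "\<And>i g. i \<in> X \<Longrightarrow> g \<in> B i \<Longrightarrow> F i g \<in> A i"
    "\<And>i g n. i \<in> X \<Longrightarrow> g \<in> B i \<Longrightarrow> eval (case_nat i g) p [n] (F i g n)"
    by (rule fam_leE) blast
  have "eval g (p_relative (p_cons (p_const i) Oracle) p) [n] (F i g n)" if "i \<in> X" "g \<in> B i" for i g n
    by (rule eval_relative[OF eval_cons F(2)[OF that]]) auto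
  then show "\<forall>i\<in>X. medvedev_le (A i) (B i)"
    using F(1) unfolding medvedev_le_iff by blast
next
  assume *: "\<forall>i\<in>X. medvedev_le (A i) (B i)"
  have "\<exists>p F. \<forall>g\<in>B i. F g \<in> A i \<and> (\<forall>n. eval g p [n] (F g n))" if "i \<in> X" for i
    using *[rule_format, OF that] unfolding medvedev_le_iff by (metis (no_types))
  then obtain P F where F: "\<And>i g. i \<in> X \<Longrightarrow> g \<in> B i \<Longrightarrow> F i g \<in> A i"
    "\<And>i g n. i \<in> X \<Longrightarrow> g \<in> B i \<Longrightarrow> eval g (P i) [n] (F i g n)"
    by metis
  \<comment> \<open>The joint program has the index in front of its oracle; \<open>p_tail\<close>
    hides it from the individual programs.\<close>
  have "eval f (p_relative p_tail (P i)) [n] (F i (\<lambda>n. f (Suc n)) n)"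
    if "i \<in> X" "(\<lambda>n. f (Suc n)) \<in> B i" for i f n
    by (rule eval_relative[OF _ F(2)[OF that]]) simp
  then obtain p where p: "\<And>i n f. i \<in> X \<Longrightarrow> (\<lambda>n. f (Suc n)) \<in> B i \<Longrightarrow>
      eval f p [i, n] (F i (\<lambda>n. f (Suc n)) n)"
    using finite_choice_program[OF assms, of "\<lambda>i f. (\<lambda>n. f (Suc n)) \<in> B i" "\<lambda>i f. F i (\<lambda>n. f (Suc n))"]
    by blast
  show "fam_le X A B"
  proof (rule fam_leI[where p = "Comp p [p_head, Proj 0]"])
    fix i g
    assume "i \<in> X" "g \<in> B i"
    then show "\<exists>f\<in>A i. \<forall>n. eval (case_nat i g) (Comp p [p_head, Proj 0]) [n] (f n)"
      using p[of i "case_nat i g"] F(1) by auto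
  qed
qed

lemma medvedev_le_refl: "medvedev_le A A"
  using fam_le_refl[of "{0}" "\<lambda>_. A"] by (simp add: fam_le_finite_iff)

lemma medvedev_le_trans: "medvedev_le A B \<Longrightarrow> medvedev_le B C \<Longrightarrow> medvedev_le A C"
  using fam_le_trans[of "{0}" "\<lambda>_. A" "\<lambda>_. B" "\<lambda>_. C"] by (simp add: fam_le_finite_iff)

subsection \<open>Join and meet\<close>

text \<open>The two halves are columns 0 and 1 under \<open>pair\<close> instead of the even and odd
  places, matching the columns of \<open>fam_all\<close>; the other columns are arbitrary.\<close>

definition fam_join :: "(nat \<Rightarrow> mass_problem) \<Rightarrow> (nat \<Rightarrow> mass_problem) \<Rightarrow> nat \<Rightarrow> mass_problem" where
  "fam_join A B i = {h. (\<lambda>n. h (pair 0 n)) \<in> A i \<and> (\<lambda>n. h (pair 1 n)) \<in> B i}"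

definition fam_meet :: "(nat \<Rightarrow> mass_problem) \<Rightarrow> (nat \<Rightarrow> mass_problem) \<Rightarrow> nat \<Rightarrow> mass_problem" where
  "fam_meet A B i = case_nat 0 ` A i \<union> case_nat 1 ` B i"

lemma fam_join_upper:
  "fam_le X A (fam_join A B)" "fam_le X B (fam_join A B)"
  by (rule fam_leI[where p = "Comp Oracle [Comp Succ [Comp p_pair [p_const 0, Proj 0]]]"],
      force simp: fam_join_def)
    (rule fam_leI[where p = "Comp Oracle [Comp Succ [Comp p_pair [p_const 1, Proj 0]]]"],
      force simp: fam_join_def)

lemma fam_join_least:
  assumes "fam_le X A C" "fam_le X B C"
  shows "fam_le X (fam_join A B) C"
proof -
  obtain p F where F: "\<And>i g. i \<in> X \<Longrightarrow> g \<in> C i \<Longrightarrow> F i g \<in> A i"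
    "\<And>i g n. i \<in> X \<Longrightarrow> g \<in> C i \<Longrightarrow> eval (case_nat i g) p [n] (F i g n)"
    using assms(1) by (rule fam_leE) blast
  obtain q G where G: "\<And>i g. i \<in> X \<Longrightarrow> g \<in> C i \<Longrightarrow> G i g \<in> B i"
    "\<And>i g n. i \<in> X \<Longrightarrow> g \<in> C i \<Longrightarrow> eval (case_nat i g) q [n] (G i g n)"
    using assms(2) by (rule fam_leE) blast
  show ?thesis
  proof (rule fam_leI[where p = "Comp p_cond [p_fst, Comp p [p_snd], Comp q [p_snd]]"])
    fix i g
    assume *: "i \<in> X" "g \<in> C i"
    let ?h = "\<lambda>z. if pfst z = 0 then F i g (psnd z) else G i g (psnd z)"
    have "?h \<in> fam_join A B i"
      using F(1)[OF *] G(1)[OF *] by (simp add: fam_join_def)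
    moreover have "eval (case_nat i g) (Comp p_cond [p_fst, Comp p [p_snd], Comp q [p_snd]]) [n] (?h n)" for n
      by (simp add: eval_iff[OF F(2)[OF *]] eval_iff[OF G(2)[OF *]])
    ultimately show "\<exists>f\<in>fam_join A B i. \<forall>n.
        eval (case_nat i g) (Comp p_cond [p_fst, Comp p [p_snd], Comp q [p_snd]]) [n] (f n)"
      by (intro bexI[of _ ?h]) auto
  qed
qed

lemma fam_meet_lower:
  "fam_le X (fam_meet A B) A" "fam_le X (fam_meet A B) B"
proof -
  have "eval (case_nat i g) (p_cons (p_const k) p_tail) [n] (case_nat k g n)" for i g k n
    by (rule eval_cons) auto
  note cons = this
  show "fam_le X (fam_meet A B) A"
    by (rule fam_leI[where p = "p_cons (p_const 0) p_tail"]) (use cons[of _ _ 0] in \<open>force simp: fam_meet_def\<close>)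
  show "fam_le X (fam_meet A B) B"
    by (rule fam_leI[where p = "p_cons (p_const 1) p_tail"]) (use cons[of _ _ 1] in \<open>force simp: fam_meet_def\<close>)
qed

lemma fam_meet_greatest:
  assumes "fam_le X C A" "fam_le X C B"
  shows "fam_le X C (fam_meet A B)"
proof -
  obtain p F where F: "\<And>i g. i \<in> X \<Longrightarrow> g \<in> A i \<Longrightarrow> F i g \<in> C i"
    "\<And>i g n. i \<in> X \<Longrightarrow> g \<in> A i \<Longrightarrow> eval (case_nat i g) p [n] (F i g n)"
    using assms(1) by (rule fam_leE) blast
  obtain q G where G: "\<And>i g. i \<in> X \<Longrightarrow> g \<in> B i \<Longrightarrow> G i g \<in> C i"
    "\<And>i g n. i \<in> X \<Longrightarrow> g \<in> B i \<Longrightarrow> eval (case_nat i g) q [n] (G i g n)"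
    using assms(2) by (rule fam_leE) blast
  \<comment> \<open>The oracle consists of the index, the tag and the solution; \<open>drop\<close>
    deletes the tag.\<close>
  define drop where "drop = p_cons p_head (Comp Oracle [Comp Succ [Succ]])"
  have drop: "eval (case_nat i (case_nat k g)) drop [n] (case_nat i g n)" for i k n and g :: "nat \<Rightarrow> nat"
    unfolding drop_def by (rule eval_cons) auto
  \<comment> \<open>The tag stands at place 1 of the oracle. The program belonging to the other tag
    may diverge, hence \<open>p_if\<close>; the repeated \<open>Proj 0\<close> only fills its third
    argument.\<close>
  define r where "r = Comp (p_if (Comp (p_relative drop p) [Proj 0]) (Comp (p_relative drop q) [Proj 0]))
      [Comp Oracle [p_const 1], Proj 0, Proj 0]"
  show ?thesis
  proof (rule fam_leI[where p = r])
    fix i h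
    assume i: "i \<in> X" and "h \<in> fam_meet A B i"
    then consider g where "h = case_nat 0 g" "g \<in> A i" | g where "h = case_nat 1 g" "g \<in> B i"
      unfolding fam_meet_def by blast
    then show "\<exists>f\<in>C i. \<forall>n. eval (case_nat i h) r [n] (f n)"
    proof cases
      case 1
      then have "eval (case_nat i h) r [n] (F i g n)" for n
        using eval_relative[OF drop F(2)[OF i]] by (simp add: r_def)
      then show ?thesis using F(1)[OF i] 1 by blast
    next
      case 2
      then have "eval (case_nat i h) r [n] (G i g n)" for n
        using eval_relative[OF drop G(2)[OF i]] by (simp add: r_def)
      then show ?thesis using G(1)[OF i] 2 by blast
    qed
  qed
qed

subsection \<open>Implication\<close>

text \<open>In place of an index of a functional, an element of the implication is a Kleene associate:
  it tells, for an argument \<^term>\<open>x\<close> and an initial segment of the oracle, either a value or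
  that the segment is too short. This avoids an enumeration of the programs.\<close>

definition prefix_code :: "(nat \<Rightarrow> nat) \<Rightarrow> nat \<Rightarrow> nat" where
  "prefix_code g n = rec_nat 0 (\<lambda>m c. pair (g m) c) n"

text \<open>The length has to be recorded: as \<open>pair 0 0\<close> is 0, all initial segments of
  the zero function have the same \<open>prefix_code\<close>. It will also be the cut-off for
  searches.\<close>

definition segment :: "(nat \<Rightarrow> nat) \<Rightarrow> nat \<Rightarrow> nat" where
  "segment g n = pair n (prefix_code g n)"

definition associate_maps :: "(nat \<Rightarrow> nat) \<Rightarrow> (nat \<Rightarrow> nat) \<Rightarrow> (nat \<Rightarrow> nat) \<Rightarrow> bool" where
  "associate_maps w g b \<longleftrightarrow>
     (\<forall>x. \<exists>n. w (pair x (segment g n)) = Suc (b x) \<and> (\<forall>m<n. w (pair x (segment g m)) = 0))"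

definition fam_imp :: "(nat \<Rightarrow> mass_problem) \<Rightarrow> (nat \<Rightarrow> mass_problem) \<Rightarrow> nat \<Rightarrow> mass_problem" where
  "fam_imp A B i = {w. \<forall>g\<in>A i. \<exists>b\<in>B i. associate_maps w g b}"

text \<open>The code is a stack with the latest value on top, so \<open>g m\<close> lies below
  \<open>n - Suc m\<close> later values.\<close>

lemma prefix_code_nth: "m < n \<Longrightarrow> pfst ((psnd ^^ (n - Suc m)) (prefix_code g n)) = g m"
proof -
  assume "m < n"
  then obtain k where k: "n = k + Suc m"
    by (metis add.commute less_imp_add_positive add_Suc_right add_Suc less_natE)
  have "(psnd ^^ k) (prefix_code g (k + Suc m)) = prefix_code g (Suc m)"
    by (induction k) (simp_all add: prefix_code_def funpow_Suc_right del: funpow.simps)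
  then show ?thesis by (simp add: k prefix_code_def)
qed

text \<open>Column 0 holds the argument \<open>g\<close>, column 1 the associate \<open>w\<close>.
  The program \<open>H\<close> asks \<open>w\<close> about the segment of length \<open>n\<close>;
  the minimisation finds the first nonzero answer, and \<open>T\<close> swaps zero and nonzero for
  this purpose.\<close>

lemma fam_imp_apply: "fam_le X B (fam_join A (fam_imp A B))"
proof -
  define C where "C = Prim Zero (Comp p_pair [Comp Oracle [Comp Succ [Comp p_pair [p_const 0, Proj 1]]], Proj 0])"
  define H where "H = Comp Oracle [Comp Succ [Comp p_pair [p_const 1, Comp p_pair [Proj 1,
      Comp p_pair [Proj 0, Comp C [Proj 0]]]]]]"
  define T where "T = Comp p_cond [H, p_const 1, p_const 0]"
  show ?thesis
  proof (rule fam_leI[where p = "Comp p_pred [Comp H [Mu T, Proj 0]]"])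
    fix i u
    assume "i \<in> X" and u: "u \<in> fam_join A (fam_imp A B) i"
    define g where "g = (\<lambda>n. u (pair 0 n))"
    define w where "w = (\<lambda>n. u (pair 1 n))"
    obtain b where b: "b \<in> B i" "associate_maps w g b"
      using u by (auto simp: fam_join_def fam_imp_def g_def w_def)
    have "eval (case_nat i u) C [n] (prefix_code g n)" for n
      unfolding C_def by (rule eval_PrimI) (simp_all add: prefix_code_def g_def)
    note C = eval_iff[OF this]
    have H: "eval (case_nat i u) H [n, x] y \<longleftrightarrow> y = w (pair x (segment g n))" for n x y
      by (simp add: H_def C w_def segment_def)
    have "eval (case_nat i u) (Comp p_pred [Comp H [Mu T, Proj 0]]) [x] (b x)" for x
    proof -
      obtain n where n: "w (pair x (segment g n)) = Suc (b x)" "\<forall>m<n. w (pair x (segment g m)) = 0"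
        using b(2) unfolding associate_maps_def by blast
      have "eval (case_nat i u) (Mu T) [x] n"
        by (rule mu) (simp_all add: T_def H n)
      note eval_iff[OF this]
      then show ?thesis by (simp add: H n)
    qed
    then show "\<exists>f\<in>B i. \<forall>n. eval (case_nat i u) (Comp p_pred [Comp H [Mu T, Proj 0]]) [n] (f n)"
      using b(1) by blast
  qed
qed

text \<open>For fixed \<open>i\<close> and \<open>c\<close> the given reduction is a functional of
  the remaining argument \<open>a\<close>. Its associate answers a query about a segment by running
  \<open>bval\<close> with that segment as the only knowledge of \<open>a\<close>, while the index
  and \<open>c\<close> are read from the actual oracle.\<close>

lemma fam_imp_least:
  assumes "fam_le X B (fam_join A C)"
  shows "fam_le X (fam_imp A B) C"
proof -
  obtain p F where F: "\<And>i g. i \<in> X \<Longrightarrow> g \<in> fam_join A C i \<Longrightarrow> F i g \<in> B i"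
    "\<And>i g n. i \<in> X \<Longrightarrow> g \<in> fam_join A C i \<Longrightarrow> eval (case_nat i g) p [n] (F i g n)"
    using assms by (rule fam_leE) blast
  \<comment> \<open>Place 0 of the simulated oracle is the index, column 0 after it comes from the
    segment and is undefined beyond its length, and every other column is \<open>c\<close>, read
    from \<open>f\<close> one place to the right of the index.\<close>
  define L where "L f \<sigma> y = (if y = 0 then Suc (f 0) else if pfst (y - 1) = 0 then
      (if Suc (psnd (y - 1)) - pfst \<sigma> = 0
       then Suc (pfst ((psnd ^^ (pfst \<sigma> - Suc (psnd (y - 1)))) (psnd \<sigma>))) else 0)
    else Suc (f (Suc (psnd (y - 1)))))" for f :: "nat \<Rightarrow> nat" and \<sigma> y
  define I where "I = Prim (Proj 0) (Comp p_snd [Proj 0])"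
  have "eval f I [k, c] ((psnd ^^ k) c)" for f k c
    unfolding I_def by (rule eval_PrimI) auto
  note I = eval_iff[OF this]
  define M where "M = Comp p_snd [Comp p_pred [Proj 0]]"
  define look where "look = Comp p_cond [Comp p_sub [Comp Succ [M], Comp p_fst [Proj 1]],
      Comp Succ [Comp p_fst [Comp I [Comp p_sub [Comp p_fst [Proj 1], Comp Succ [M]], Comp p_snd [Proj 1]]]],
      p_const 0]"
  define l where "l = Comp p_cond [Proj 0, Comp Succ [p_head],
      Comp p_cond [Comp p_fst [Comp p_pred [Proj 0]], look, Comp Succ [Comp Oracle [Comp Succ [M]]]]]"
  have M: "eval f M [x, \<sigma>] y \<longleftrightarrow> y = psnd (x - 1)" for f x \<sigma> y
    by (simp add: M_def)
  have look: "eval f look [x, \<sigma>] y \<longleftrightarrow> y = (if Suc (psnd (x - 1)) - pfst \<sigma> = 0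
      then Suc (pfst ((psnd ^^ (pfst \<sigma> - Suc (psnd (x - 1)))) (psnd \<sigma>))) else 0)" for f x \<sigma> y
    by (simp add: look_def M I)
  have "eval f l [x, \<sigma>] (L f \<sigma> x)" for f x \<sigma>
    by (simp add: l_def look M L_def)
  from bval_program[where k = 1 and p = p and L = L, OF this] obtain r where
    "\<forall>f \<sigma> xs. length xs = 1 \<longrightarrow> eval f r (xs @ [\<sigma>]) (bval (L f \<sigma>) (pfst \<sigma>) p xs)"
    by blast
  from this[rule_format, of "[_]"] have
    r: "eval f r [x, \<sigma>] (bval (L f \<sigma>) (pfst \<sigma>) p [x])" for f \<sigma> x
    by simp
  show ?thesis
  proof (rule fam_leI[where p = "Comp r [p_fst, p_snd]"])
    fix i c
    assume i: "i \<in> X" and c: "c \<in> C i"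
    let ?f = "case_nat i c"
    define w where "w z = bval (L ?f (psnd z)) (pfst (psnd z)) p [pfst z]" for z
    have "w \<in> fam_imp A B i"
      unfolding fam_imp_def
    proof (intro CollectI ballI)
      fix a
      assume a: "a \<in> A i"
      define u where "u = (\<lambda>z. if pfst z = 0 then a (psnd z) else c (psnd z))"
      have u: "u \<in> fam_join A C i"
        using a c by (simp add: fam_join_def u_def)
      have val: "L ?f (segment a s) y = (if y \<noteq> 0 \<and> pfst (y - 1) = 0 \<and> s \<le> psnd (y - 1) then 0
          else Suc (case_nat i u y))" for s y
        by (cases y) (simp_all add: L_def segment_def prefix_code_nth u_def)
      have "eventually (\<lambda>s. L ?f (segment a s) y = Suc (case_nat i u y)) sequentially" for y
        using eventually_gt_at_top[of "psnd (y - 1)"] by eventually_elim (simp add: val)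
      then have appr: "(\<forall>s. bval (L ?f (segment a s)) s p [x] = 0 \<or> bval (L ?f (segment a s)) s p [x] = Suc (F i u x)) \<and>
          eventually (\<lambda>s. bval (L ?f (segment a s)) s p [x] = Suc (F i u x)) sequentially" for x
        by (intro bval_approximates[where g = "case_nat i u"] F(2)[OF i u]) (simp add: val)
      have "associate_maps w a (F i u)"
        unfolding associate_maps_def
      proof
        fix x
        let ?b = "\<lambda>s. bval (L ?f (segment a s)) s p [x]"
        \<comment> \<open>The length of the segment doubles as the cut-off, so the answer to the
          segment of length \<open>s\<close> is stage \<open>s\<close> of the approximation.\<close>
        have w: "w (pair x (segment a s)) = ?b s" for s
          by (simp add: w_def segment_def)
        have "\<exists>s. ?b s = Suc (F i u x)"
          using appr[of x] by (intro eventually_happens'[OF sequentially_bot]) blast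
        then have "\<exists>s. ?b s \<noteq> 0"
          by (metis nat.distinct(1))
        then have "?b (LEAST s. ?b s \<noteq> 0) \<noteq> 0"
          by (rule LeastI_ex)
        then have "?b (LEAST s. ?b s \<noteq> 0) = Suc (F i u x)"
          using conjunct1[OF appr[of x], THEN spec, of "LEAST s. ?b s \<noteq> 0"] by simp
        moreover have "?b m = 0" if "m < (LEAST s. ?b s \<noteq> 0)" for m
          using not_less_Least[OF that] by simp
        ultimately show "\<exists>n. w (pair x (segment a n)) = Suc (F i u x) \<and>
            (\<forall>m<n. w (pair x (segment a m)) = 0)"
          unfolding w by blast
      qed
      then show "\<exists>b\<in>B i. associate_maps w a b"
        using F(1)[OF i u] by blast
    qed
    moreover have "eval ?f (Comp r [p_fst, p_snd]) [n] (w n)" for n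
      using r by (simp add: w_def)
    ultimately show "\<exists>f\<in>fam_imp A B i. \<forall>n. eval ?f (Comp r [p_fst, p_snd]) [n] (f n)"
      by blast
  qed
qed

lemma fam_imp_adjoint: "fam_le X B (fam_join A C) \<longleftrightarrow> fam_le X (fam_imp A B) C"
proof
  assume "fam_le X (fam_imp A B) C"
  then have "fam_le X (fam_join A (fam_imp A B)) (fam_join A C)"
    by (meson fam_join_least fam_join_upper fam_le_trans)
  then show "fam_le X B (fam_join A C)"
    using fam_imp_apply fam_le_trans by blast
qed (rule fam_imp_least)

subsection \<open>Quantifiers\<close>

definition fam_ex :: "(nat \<Rightarrow> nat \<Rightarrow> nat) \<Rightarrow> nat set \<Rightarrow> (nat \<Rightarrow> mass_problem) \<Rightarrow> nat \<Rightarrow> mass_problem" where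
  "fam_ex pr X A i = (\<Union>j\<in>X. case_nat j ` A (pr i j))"

definition fam_all :: "(nat \<Rightarrow> nat \<Rightarrow> nat) \<Rightarrow> nat set \<Rightarrow> (nat \<Rightarrow> mass_problem) \<Rightarrow> nat \<Rightarrow> mass_problem" where
  "fam_all pr X A i = {h. \<forall>j\<in>X. (\<lambda>n. h (pair j n)) \<in> A (pr i j)}"

text \<open>This is what a product diagram amounts to on indices: a bijection of \<open>Q\<close>
  with the pairs from \<open>\<Gamma>\<close> and \<open>X\<close>, computable in both
  directions.\<close>

locale index_product =
  fixes \<Gamma> X Q :: "nat set" and \<pi> \<rho> :: "nat \<Rightarrow> nat" and pr :: "nat \<Rightarrow> nat \<Rightarrow> nat"
  assumes \<pi>: "q \<in> Q \<Longrightarrow> \<pi> q \<in> \<Gamma>" and \<rho>: "q \<in> Q \<Longrightarrow> \<rho> q \<in> X"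
    and pr: "\<lbrakk>i \<in> \<Gamma>; j \<in> X\<rbrakk> \<Longrightarrow> pr i j \<in> Q" "\<lbrakk>i \<in> \<Gamma>; j \<in> X\<rbrakk> \<Longrightarrow> \<pi> (pr i j) = i"
      "\<lbrakk>i \<in> \<Gamma>; j \<in> X\<rbrakk> \<Longrightarrow> \<rho> (pr i j) = j" "q \<in> Q \<Longrightarrow> pr (\<pi> q) (\<rho> q) = q"
    and computable_\<pi>: "computable_on Q \<pi>" and computable_\<rho>: "computable_on Q \<rho>"
    and computable_pr: "computable_on2 \<Gamma> X pr"
begin

text \<open>An oracle made of \<open>i\<close>, \<open>j\<close> and a solution carries the same
  information as one made of \<open>pr i j\<close> and that solution; each direction only rewrites
  the front of the oracle.\<close>

lemma fam_ex_adjoint: "fam_le Q (\<lambda>q. B (\<pi> q)) A \<longleftrightarrow> fam_le \<Gamma> B (fam_ex pr X A)"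
proof
  assume le: "fam_le Q (\<lambda>q. B (\<pi> q)) A"
  obtain p where p: "\<And>i j f. i \<in> \<Gamma> \<Longrightarrow> j \<in> X \<Longrightarrow> eval f p [i, j] (pr i j)"
    using computable_pr unfolding computable_on2_def by blast
  show "fam_le \<Gamma> B (fam_ex pr X A)"
  proof (rule fam_le_subst[OF le, where h = "Comp p [p_head, Comp Oracle [p_const 1]]"
        and t = "Comp Oracle [Comp Succ [Succ]]"])
    fix i g
    assume i: "i \<in> \<Gamma>" and "g \<in> fam_ex pr X A i"
    then obtain j f where "j \<in> X" "f \<in> A (pr i j)" "g = case_nat j f"
      unfolding fam_ex_def by blast
    then show "\<exists>q\<in>Q. \<exists>g'\<in>A q. B (\<pi> q) \<subseteq> B i \<and>
        eval (case_nat i g) (Comp p [p_head, Comp Oracle [p_const 1]]) [] q \<and>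
        (\<forall>n. eval (case_nat i g) (Comp Oracle [Comp Succ [Succ]]) [n] (g' n))"
      using i pr p by (intro bexI[of _ "pr i j"] bexI[of _ f]) auto
  qed
next
  assume le: "fam_le \<Gamma> B (fam_ex pr X A)"
  obtain p where p: "\<And>q f. q \<in> Q \<Longrightarrow> eval f p [q] (\<pi> q)"
    using computable_\<pi> by (rule computable_onE) blast
  obtain r where r: "\<And>q f. q \<in> Q \<Longrightarrow> eval f r [q] (\<rho> q)"
    using computable_\<rho> by (rule computable_onE) blast
  show "fam_le Q (\<lambda>q. B (\<pi> q)) A"
  proof (rule fam_le_subst[OF le, where h = "Comp p [p_head]" and t = "p_cons (Comp r [p_head]) p_tail"])
    fix q g
    assume q: "q \<in> Q" and g: "g \<in> A q"
    have "eval (case_nat q g) (p_cons (Comp r [p_head]) p_tail) [n] (case_nat (\<rho> q) g n)" for n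
      by (rule eval_cons) (use r q in auto)
    moreover have "case_nat (\<rho> q) g \<in> fam_ex pr X A (\<pi> q)"
      using q g \<rho> pr(4) unfolding fam_ex_def by (intro UN_I[of "\<rho> q"]) auto
    ultimately show "\<exists>i\<in>\<Gamma>. \<exists>g'\<in>fam_ex pr X A i. B i \<subseteq> B (\<pi> q) \<and>
        eval (case_nat q g) (Comp p [p_head]) [] i \<and>
        (\<forall>n. eval (case_nat q g) (p_cons (Comp r [p_head]) p_tail) [n] (g' n))"
      using q p \<pi> by (intro bexI[of _ "\<pi> q"] bexI[of _ "case_nat (\<rho> q) g"]) auto
  qed
qed

text \<open>Elements of \<^term>\<open>fam_all pr X A i\<close> are total, so the columns outside \<^term>\<open>X\<close> have to be
  filled as well; this is what \<^term>\<open>cl\<close> is needed for.\<close>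

lemma fam_all_adjoint_retraction:
  assumes cl: "\<And>f j. eval f c [j] (cl j)" "\<And>j. cl j \<in> X" "\<And>j. j \<in> X \<Longrightarrow> cl j = j"
  shows "fam_le Q A (\<lambda>q. B (\<pi> q)) \<longleftrightarrow> fam_le \<Gamma> (fam_all pr X A) B"
proof
  assume "fam_le Q A (\<lambda>q. B (\<pi> q))"
  then obtain p F where F: "\<And>q g. q \<in> Q \<Longrightarrow> g \<in> B (\<pi> q) \<Longrightarrow> F q g \<in> A q"
    "\<And>q g n. q \<in> Q \<Longrightarrow> g \<in> B (\<pi> q) \<Longrightarrow> eval (case_nat q g) p [n] (F q g n)"
    by (rule fam_leE) blast
  obtain r where r: "\<And>i j f. i \<in> \<Gamma> \<Longrightarrow> j \<in> X \<Longrightarrow> eval f r [i, j] (pr i j)"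
    using computable_pr unfolding computable_on2_def by blast
  \<comment> \<open>The index to be simulated changes with the column being computed, so it is
    passed to the substituted oracle as the parameter of \<open>osub\<close>.\<close>
  define s where "s = Prim (Proj 0) (Comp p_tail [Proj 1])"
  have s: "eval (case_nat i g) s [n, q] (case_nat q g n)" for i q n and g :: "nat \<Rightarrow> nat"
    unfolding s_def by (rule eval_PrimI) auto
  show "fam_le \<Gamma> (fam_all pr X A) B"
  proof (rule fam_leI[where p = "Comp (osub s p 1) [p_snd, Comp r [p_head, Comp c [p_fst]]]"])
    fix i b
    assume i: "i \<in> \<Gamma>" and b: "b \<in> B i"
    define q where "q j = pr i (cl j)" for j
    have q: "q j \<in> Q" "b \<in> B (\<pi> (q j))" for j
      using i b cl(2) pr by (auto simp: q_def)
    define h where "h z = F (q (pfst z)) b (psnd z)" for z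
    have "h \<in> fam_all pr X A i"
      using F(1)[OF q] cl(3) unfolding fam_all_def by (auto simp: h_def) (metis q_def)
    moreover have "eval (case_nat i b) (Comp (osub s p 1) [p_snd, Comp r [p_head, Comp c [p_fst]]]) [z] (h z)" for z
      using eval_osub_1[OF s F(2)[OF q, of "pfst z" "psnd z"], of i] eval_iff[OF cl(1)]
        eval_iff[OF r[OF i cl(2)[of "pfst z"]]] by (simp add: h_def q_def)
    ultimately show "\<exists>f\<in>fam_all pr X A i. \<forall>n. eval (case_nat i b)
        (Comp (osub s p 1) [p_snd, Comp r [p_head, Comp c [p_fst]]]) [n] (f n)"
      by blast
  qed
next
  assume "fam_le \<Gamma> (fam_all pr X A) B"
  then have "fam_le Q (\<lambda>q. fam_all pr X A (\<pi> q)) (\<lambda>q. B (\<pi> q))"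
    by (rule fam_le_reindex[OF _ computable_\<pi> \<pi>])
  moreover obtain r where r: "\<And>q f. q \<in> Q \<Longrightarrow> eval f r [q] (\<rho> q)"
    using computable_\<rho> by (rule computable_onE) blast
  have "fam_le Q A (\<lambda>q. fam_all pr X A (\<pi> q))"
  proof (rule fam_leI[where p = "Comp p_tail [Comp p_pair [Comp r [p_head], Proj 0]]"])
    fix q h
    assume q: "q \<in> Q" and h: "h \<in> fam_all pr X A (\<pi> q)"
    have "(\<lambda>n. h (pair (\<rho> q) n)) \<in> A q"
      using h \<rho>[OF q] pr(4)[OF q] unfolding fam_all_def by force
    then show "\<exists>f\<in>A q. \<forall>n. eval (case_nat q h) (Comp p_tail [Comp p_pair [Comp r [p_head], Proj 0]]) [n] (f n)"
      by (rule bexI[rotated]) (use r[OF q] in auto)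
  qed
  ultimately show "fam_le Q A (\<lambda>q. B (\<pi> q))"
    using fam_le_trans by blast
qed

end

section \<open>Brouwer algebras from preorders\<close>

text \<open>Here \<open>k\<close> is the quotient map of the preorder \<open>R\<close>. Operations
  chosen on representatives then compute those of the quotient, without any work on classes.\<close>

locale brouwer_presentation =
  fixes L :: "'p gorder" (structure) and k :: "'x \<Rightarrow> 'p" and R :: "'x \<Rightarrow> 'x \<Rightarrow> bool"
    and jn mt im :: "'x \<Rightarrow> 'x \<Rightarrow> 'x" and bt tp :: 'x
  assumes carrier: "carrier L = range k" and eq: "eq L = (=)"
    and le: "k a \<sqsubseteq> k b \<longleftrightarrow> R a b" and k_eq: "k a = k b \<longleftrightarrow> R a b \<and> R b a"
    and R_refl: "R a a" and R_trans: "R a b \<Longrightarrow> R b c \<Longrightarrow> R a c"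
    and jn: "R a (jn a b)" "R b (jn a b)" "R a c \<Longrightarrow> R b c \<Longrightarrow> R (jn a b) c"
    and mt: "R (mt a b) a" "R (mt a b) b" "R c a \<Longrightarrow> R c b \<Longrightarrow> R c (mt a b)"
    and im: "R b (jn a c) \<longleftrightarrow> R (im a b) c"
    and bt: "R bt a" and tp: "R a tp"
begin

sublocale partial_order L
  by unfold_locales (use R_refl R_trans in \<open>auto simp: carrier eq le k_eq\<close>)

lemma least_jn: "least L (k (jn a b)) (Upper L {k a, k b})"
  unfolding least_def Upper_def by (auto simp: carrier le jn)

lemma greatest_mt: "greatest L (k (mt a b)) (Lower L {k a, k b})"
  unfolding greatest_def Lower_def by (auto simp: carrier le mt)

lemma least_bt: "least L (k bt) (carrier L)"
  unfolding least_def by (auto simp: carrier le bt)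

lemma greatest_tp: "greatest L (k tp) (carrier L)"
  unfolding greatest_def by (auto simp: carrier le tp)

sublocale bounded_lattice L
proof unfold_locales
  fix x y
  assume "x \<in> carrier L" "y \<in> carrier L"
  then show "\<exists>s. least L s (Upper L {x, y})" "\<exists>s. greatest L s (Lower L {x, y})"
    using least_jn greatest_mt unfolding carrier by blast+
qed (use least_bt greatest_tp in blast)+

lemma join_k: "k a \<squnion> k b = k (jn a b)"
  unfolding join_def sup_def using least_jn[of a b] least_unique by (metis (no_types, lifting) someI)

lemma meet_k: "k a \<sqinter> k b = k (mt a b)"
  unfolding meet_def inf_def using greatest_mt[of a b] greatest_unique by (metis (no_types, lifting) someI)

lemma bottom_k: "\<bottom> = k bt"
  unfolding bottom_def using least_bt least_unique by (metis (no_types, lifting) someI)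

lemma top_k: "\<top> = k tp"
  unfolding top_def using greatest_tp greatest_unique by (metis (no_types, lifting) someI)

lemma implication_k: "implication L (k a) (k b) = k (im a b)"
  unfolding implication_def
proof (rule the_equality)
  show "k (im a b) \<in> carrier L \<and> (\<forall>y\<in>carrier L. k b \<sqsubseteq> k a \<squnion> y \<longleftrightarrow> k (im a b) \<sqsubseteq> y)"
    by (auto simp: carrier join_k le im)
next
  fix w
  assume w: "w \<in> carrier L \<and> (\<forall>y\<in>carrier L. k b \<sqsubseteq> k a \<squnion> y \<longleftrightarrow> w \<sqsubseteq> y)"
  then obtain c where c: "w = k c" unfolding carrier by blast
  have "R (im a b) d \<longleftrightarrow> R c d" for d
  proof -
    have "k b \<sqsubseteq> k a \<squnion> k d \<longleftrightarrow> w \<sqsubseteq> k d"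
      using w by (simp add: carrier)
    then show ?thesis
      by (simp add: c join_k le im)
  qed
  then show "w = k (im a b)"
    unfolding c k_eq using R_refl by blast
qed

text \<open>Joining with a fixed element is a right adjoint, hence preserves meets.\<close>

lemma mt_jn_le: "R (mt a (jn b c)) (jn (mt a b) (mt a c))"
proof -
  have comm: "R x (jn u v) \<Longrightarrow> R x (jn v u)" for x u v
    using R_trans[OF _ jn(3)[OF jn(2,1)]] .
  have "R (im (mt a b) (mt a (jn b c))) a"
    unfolding im[symmetric] by (rule R_trans[OF mt(1) jn(2)])
  \<comment> \<open>Exchanging the two sides of the join and using the adjunction for
    \<open>c\<close> reduces this to lying below \<open>a\<close> and below
    \<open>b\<close>.\<close>
  moreover have "R (im (mt a b) (mt a (jn b c))) c"
    unfolding im[symmetric]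
  proof (rule comm)
    have "R (im c (mt a (jn b c))) a"
      unfolding im[symmetric] by (rule R_trans[OF mt(1) jn(2)])
    moreover have "R (im c (mt a (jn b c))) b"
      unfolding im[symmetric] by (rule comm) (rule mt(2))
    ultimately show "R (mt a (jn b c)) (jn c (mt a b))"
      unfolding im by (rule mt(3))
  qed
  ultimately show ?thesis
    unfolding im by (rule mt(3))
qed

lemma jn_mt_le: "R (jn (mt a b) (mt a c)) (mt a (jn b c))"
  by (intro jn(3) mt(3) mt(1) R_trans[OF mt(2)] jn(1,2))

lemma brouwer_algebra: "brouwer_algebra L"
proof unfold_locales
  fix x y z
  assume "x \<in> carrier L" "y \<in> carrier L" "z \<in> carrier L"
  then show "x \<sqinter> (y \<squnion> z) = (x \<sqinter> y) \<squnion> (x \<sqinter> z)"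
    using mt_jn_le jn_mt_le by (auto simp: carrier join_k meet_k k_eq)
next
  fix x z
  assume "x \<in> carrier L" "z \<in> carrier L"
  then obtain a b where "x = k a" "z = k b" unfolding carrier by blast
  then show "\<exists>w\<in>carrier L. \<forall>y\<in>carrier L. z \<sqsubseteq> x \<squnion> y \<longleftrightarrow> w \<sqsubseteq> y"
    by (intro bexI[of _ "k (im a b)"]) (auto simp: carrier join_k le im)
qed

end

section \<open>Predicates\<close>

lemma comp_objects_cases:
  assumes "X \<in> comp_objects"
  obtains "X = UNIV" | n where "X = {1..n}" "1 \<le> n"
  using assms unfolding comp_objects_def by blast

lemma comp_objects_finite: "X \<in> comp_objects \<Longrightarrow> X \<noteq> UNIV \<Longrightarrow> finite X"
  by (auto elim: comp_objects_cases)

lemma equiv_of_class_eq: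
  assumes "\<And>a. R a a" "\<And>a b c. R a b \<Longrightarrow> R b c \<Longrightarrow> R a c"
  shows "equiv_of R `` {a} = equiv_of R `` {b} \<longleftrightarrow> R a b \<and> R b a"
proof
  assume "equiv_of R `` {a} = equiv_of R `` {b}"
  moreover have "b \<in> equiv_of R `` {b}"
    by (simp add: equiv_of_def assms(1))
  ultimately show "R a b \<and> R b a"
    by (auto simp: equiv_of_def)
next
  assume "R a b \<and> R b a"
  then show "equiv_of R `` {a} = equiv_of R `` {b}"
    unfolding equiv_of_def using assms(2) by blast
qed

lemma class_le_iff:
  assumes "\<And>a. R a a" "\<And>a b c. R a b \<Longrightarrow> R b c \<Longrightarrow> R a c"
  shows "class_le R (equiv_of R `` {a}) (equiv_of R `` {b}) \<longleftrightarrow> R a b"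
proof
  assume "class_le R (equiv_of R `` {a}) (equiv_of R `` {b})"
  then obtain c d where "R a c" "R c d" "R d b"
    unfolding class_le_def equiv_of_def by auto
  then show "R a b"
    using assms(2) by blast
next
  assume "R a b"
  then show "class_le R (equiv_of R `` {a}) (equiv_of R `` {b})"
    unfolding class_le_def by (intro bexI[of _ a] bexI[of _ b]) (simp_all add: equiv_of_def assms(1))
qed

lemma some_in_class:
  assumes "\<And>a. R a a"
  shows "(SOME b. b \<in> equiv_of R `` {a}) \<in> equiv_of R `` {a}"
  by (rule someI[of _ a]) (simp add: equiv_of_def assms)

lemma predicate_le_iff:
  assumes "X \<in> comp_objects"
  shows "predicate_le X (predicate_of X A) (predicate_of X B) \<longleftrightarrow> fam_le X A B"
proof (cases "X = UNIV")
  case True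
  then show ?thesis
    using class_le_iff[of "fam_le UNIV" A B] fam_le_refl fam_le_trans
    by (simp add: predicate_of_def medvedev_omega_le_iff)
next
  case False
  then show ?thesis
    using class_le_iff[of medvedev_le] medvedev_le_refl medvedev_le_trans
      comp_objects_finite[OF assms] by (simp add: predicate_of_def fam_le_finite_iff)
qed

lemma predicate_of_eq_iff:
  assumes "X \<in> comp_objects"
  shows "predicate_of X A = predicate_of X B \<longleftrightarrow> fam_le X A B \<and> fam_le X B A"
proof (cases "X = UNIV")
  case True
  then show ?thesis
    using equiv_of_class_eq[of "fam_le UNIV" A B] fam_le_refl fam_le_trans
    by (simp add: predicate_of_def medvedev_omega_le_iff)
next
  case False
  have "equiv_of medvedev_le `` {a} = equiv_of medvedev_le `` {b} \<longleftrightarrow>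
      medvedev_le a b \<and> medvedev_le b a" for a b
    by (rule equiv_of_class_eq) (use medvedev_le_refl medvedev_le_trans in blast)+
  then show ?thesis
    using False comp_objects_finite[OF assms]
    by (auto simp: predicate_of_def fam_le_finite_iff fun_eq_iff restrict_def)
qed

lemma predicate_of_cong: "(\<And>i. i \<in> X \<Longrightarrow> A i = B i) \<Longrightarrow> predicate_of X A = predicate_of X B"
proof -
  assume *: "\<And>i. i \<in> X \<Longrightarrow> A i = B i"
  then have "X = UNIV \<Longrightarrow> A = B" by auto
  with * show ?thesis by (simp add: predicate_of_def cong: restrict_cong)
qed

text \<open>For finite \<open>X\<close> the members are picked separately in each component; they
  still form an equivalent family, as finitely many reductions combine into a uniform one.\<close>

lemma predicate_of_representative:
  assumes "X \<in> comp_objects"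
  shows "predicate_of X (representative (predicate_of X A)) = predicate_of X A"
proof (cases "X = UNIV")
  case True
  have "(SOME B. B \<in> equiv_of (fam_le UNIV) `` {A}) \<in> equiv_of (fam_le UNIV) `` {A}"
    by (rule some_in_class) (rule fam_le_refl)
  moreover have "representative (Omega D) = (SOME B. B \<in> D)" for D
    by (rule ext) simp
  ultimately show ?thesis
    unfolding predicate_of_eq_iff[OF assms] using True
    by (simp add: predicate_of_def medvedev_omega_le_iff equiv_of_def)
next
  case False
  have "(SOME b. b \<in> equiv_of medvedev_le `` {a}) \<in> equiv_of medvedev_le `` {a}" for a
    by (rule some_in_class) (rule medvedev_le_refl)
  then show ?thesis
    unfolding predicate_of_eq_iff[OF assms] using False comp_objects_finite[OF assms]
    by (auto simp: predicate_of_def equiv_of_def fam_le_finite_iff)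
qed

lemma carrier_mass_P:
  assumes "X \<in> comp_objects"
  shows "carrier (mass_P X) = range (predicate_of X)"
proof (cases "X = UNIV")
  case True
  then show ?thesis
    by (auto simp: mass_P_def predicate_of_def medvedev_omega_degrees_def quotient_def)
next
  case False
  have "Tuple D \<in> range (predicate_of X)" if D: "D \<in> X \<rightarrow>\<^sub>E medvedev_degrees" for D
  proof -
    have "\<forall>i\<in>X. \<exists>a. D i = equiv_of medvedev_le `` {a}"
      using D by (force simp: medvedev_degrees_def quotient_def)
    then obtain A where "\<forall>i\<in>X. D i = equiv_of medvedev_le `` {A i}"
      by (rule bchoice[THEN exE])
    then have "D i = (\<lambda>i\<in>X. equiv_of medvedev_le `` {A i}) i" for i
      using PiE_arb[OF D] by (cases "i \<in> X") simp_all
    then have "D = (\<lambda>i\<in>X. equiv_of medvedev_le `` {A i})"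
      by (rule ext)
    then show ?thesis
      using False by (auto simp: predicate_of_def)
  qed
  moreover have "predicate_of X A \<in> Tuple ` (X \<rightarrow>\<^sub>E medvedev_degrees)" for A
    using False by (auto simp: predicate_of_def medvedev_degrees_def quotient_def intro!: imageI)
  ultimately have "Tuple ` (X \<rightarrow>\<^sub>E medvedev_degrees) = range (predicate_of X)"
    by (intro equalityI subsetI; elim imageE; simp only:)
  then show ?thesis
    using False by (simp add: mass_P_def)
qed

lemma mass_P_presentation:
  assumes "X \<in> comp_objects"
  shows "brouwer_presentation (mass_P X) (predicate_of X) (fam_le X) fam_join fam_meet fam_imp
    (\<lambda>_. UNIV) (\<lambda>_. {})"
proof
  show "eq (mass_P X) = (=)"
    by (simp add: mass_P_def)
  show "predicate_of X A \<sqsubseteq>\<^bsub>mass_P X\<^esub> predicate_of X B \<longleftrightarrow> fam_le X A B" for A B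
    using predicate_le_iff[OF assms] by (simp add: mass_P_def)
  show "fam_le X B (fam_join A C) \<longleftrightarrow> fam_le X (fam_imp A B) C" for A B C
    by (rule fam_imp_adjoint)
qed (use assms in \<open>auto intro: fam_le_refl fam_le_trans fam_join_upper fam_join_least fam_meet_lower
    fam_meet_greatest fam_le_subset simp: carrier_mass_P predicate_of_eq_iff\<close>)

lemma mass_P_cases:
  assumes "v \<in> carrier (mass_P X)" "X \<in> comp_objects"
  obtains A where "v = predicate_of X A"
  using assms by (auto simp: carrier_mass_P)

lemma predicate_of_in_carrier: "X \<in> comp_objects \<Longrightarrow> predicate_of X A \<in> carrier (mass_P X)"
  by (simp add: carrier_mass_P)

lemma mass_P_le: "X \<in> comp_objects \<Longrightarrow>
    predicate_of X A \<sqsubseteq>\<^bsub>mass_P X\<^esub> predicate_of X B \<longleftrightarrow> fam_le X A B"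
  using brouwer_presentation.le[OF mass_P_presentation] .

section \<open>The category of computable functions\<close>

lemma comp_category_simps [simp]:
  "Obj comp_category = comp_objects"
  "Dom comp_category (X, \<alpha>, Y) = X" "Cod comp_category (X, \<alpha>, Y) = Y"
  "Id comp_category X = (X, restrict id X, X)"
  "Cmp comp_category (Y, \<beta>, Z) (X, \<alpha>, Y') = (X, compose X \<beta> \<alpha>, Z)"
  by (simp_all add: comp_category_def)

lemma hom_comp_category: "f \<in> hom comp_category X Y \<longleftrightarrow> (\<exists>\<alpha>. f = (X, \<alpha>, Y) \<and>
    X \<in> comp_objects \<and> Y \<in> comp_objects \<and> \<alpha> \<in> X \<rightarrow>\<^sub>E Y \<and> computable_on X \<alpha>)"
  by (auto simp: hom_def comp_category_def)

lemma computable_on_cong: "computable_on X \<alpha> \<Longrightarrow> (\<And>i. i \<in> X \<Longrightarrow> \<alpha> i = \<beta> i) \<Longrightarrow> computable_on X \<beta>"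
  unfolding computable_on_def by simp

lemma computable_on_compose:
  assumes "computable_on X \<alpha>" "computable_on Y \<beta>" "\<And>i. i \<in> X \<Longrightarrow> \<alpha> i \<in> Y"
  shows "computable_on X (\<lambda>i. \<beta> (\<alpha> i))"
proof -
  obtain a where a: "\<And>i f. i \<in> X \<Longrightarrow> eval f a [i] (\<alpha> i)"
    using assms(1) by (rule computable_onE) blast
  obtain b where b: "\<And>i f. i \<in> Y \<Longrightarrow> eval f b [i] (\<beta> i)"
    using assms(2) by (rule computable_onE) blast
  show ?thesis
  proof (rule computable_onI[where p = "Comp b [a]"])
    fix i
    assume i: "i \<in> X"
    show "eval (\<lambda>_. 0) (Comp b [a]) [i] (\<beta> (\<alpha> i))"
      using a[OF i] b[OF assms(3)[OF i]] by auto
  qed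
qed

lemma computable_on_id: "computable_on X (restrict id X)"
  by (rule computable_onI[where p = "Proj 0"]) simp

lemma category_comp_category: "category comp_category"
proof
  show "Dom comp_category f \<in> Obj comp_category \<and> Cod comp_category f \<in> Obj comp_category"
    if "f \<in> Arr comp_category" for f
    using that by (auto simp: comp_category_def)
  show "Id comp_category X \<in> hom comp_category X X" if "X \<in> Obj comp_category" for X
    using that by (simp add: hom_comp_category computable_on_id)
next
  fix f X Y
  assume "f \<in> hom comp_category X Y"
  then obtain \<alpha> where f: "f = (X, \<alpha>, Y)" "\<alpha> \<in> X \<rightarrow>\<^sub>E Y" "X \<in> comp_objects" "computable_on X \<alpha>"
    unfolding hom_comp_category by blast
  have "compose X (restrict id Y) \<alpha> i = \<alpha> i" "compose X \<alpha> (restrict id X) i = \<alpha> i" for i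
    using PiE_mem[OF f(2)] PiE_arb[OF f(2)] by (cases "i \<in> X"; simp add: compose_def)+
  then show "Cmp comp_category (Id comp_category Y) f = f" "Cmp comp_category f (Id comp_category X) = f"
    by (simp_all add: f(1) ext)
  fix g Z
  assume "g \<in> hom comp_category Y Z"
  then obtain \<beta> where g: "g = (Y, \<beta>, Z)" "\<beta> \<in> Y \<rightarrow>\<^sub>E Z" "Z \<in> comp_objects" "computable_on Y \<beta>"
    unfolding hom_comp_category by blast
  have "computable_on X (compose X \<beta> \<alpha>)"
    by (rule computable_on_cong[OF computable_on_compose[OF f(4) g(4)]])
      (use PiE_mem[OF f(2)] in \<open>auto simp: compose_def\<close>)
  then show "Cmp comp_category g f \<in> hom comp_category X Z"
    using f g by (auto simp: hom_comp_category compose_def)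
  fix h W
  assume "h \<in> hom comp_category Z W"
  then obtain \<gamma> where h: "h = (Z, \<gamma>, W)"
    unfolding hom_comp_category by blast
  have "\<alpha> \<in> X \<rightarrow> Y"
    using f(2) by auto
  then show "Cmp comp_category h (Cmp comp_category g f) = Cmp comp_category (Cmp comp_category h g) f"
    by (simp add: f(1) g(1) h compose_assoc)
qed

interpretation category comp_category
  by (rule category_comp_category)

subsection \<open>Products\<close>

text \<open>An upward search from \<open>d\<close> never leaves \<open>Q\<close> before it reaches
  its goal. Outside \<open>Q\<close> the programs for the projections might diverge and block
  it.\<close>

lemma comp_objects_search_start:
  assumes "Q \<in> comp_objects"
  obtains d where "\<And>q. q \<in> Q \<Longrightarrow> d \<le> q" "\<And>q r. q \<in> Q \<Longrightarrow> d \<le> r \<Longrightarrow> r \<le> q \<Longrightarrow> r \<in> Q"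
  using assms by (cases rule: comp_objects_cases) (fastforce intro: that[of 0] that[of 1])+

text \<open>The pair is found by searching for an element with the prescribed projections:
  \<open>T\<close> adds up the two distances and vanishes exactly at a hit, and \<open>uniq\<close>
  excludes an earlier hit.\<close>

lemma computable_on2_inverse:
  assumes Q: "Q \<in> comp_objects" and "computable_on Q \<pi>" "computable_on Q \<rho>"
    and pr: "\<And>i j. i \<in> \<Gamma> \<Longrightarrow> j \<in> X \<Longrightarrow> pr i j \<in> Q \<and> \<pi> (pr i j) = i \<and> \<rho> (pr i j) = j"
    and uniq: "\<And>q q'. q \<in> Q \<Longrightarrow> q' \<in> Q \<Longrightarrow> \<pi> q = \<pi> q' \<Longrightarrow> \<rho> q = \<rho> q' \<Longrightarrow> q = q'"
  shows "computable_on2 \<Gamma> X pr"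
proof -
  obtain p where "\<And>q f. q \<in> Q \<Longrightarrow> eval f p [q] (\<pi> q)"
    using assms(2) by (rule computable_onE) blast
  note p = eval_iff[OF this]
  obtain r where "\<And>q f. q \<in> Q \<Longrightarrow> eval f r [q] (\<rho> q)"
    using assms(3) by (rule computable_onE) blast
  note r = eval_iff[OF this]
  obtain d where d: "\<And>q. q \<in> Q \<Longrightarrow> d \<le> q" "\<And>q r. q \<in> Q \<Longrightarrow> d \<le> r \<Longrightarrow> r \<le> q \<Longrightarrow> r \<in> Q"
    using comp_objects_search_start[OF Q] by blast
  define D where "D a b = Comp p_add [Comp p_sub [a, b], Comp p_sub [b, a]]" for a b
  define q where "q = Comp p_add [Proj 0, p_const d]"
  define T where "T = Comp p_add [D (Comp p [q]) (Proj 1), D (Comp r [q]) (Proj 2)]"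
  have "eval f (Comp p_add [Mu T, p_const d]) [i, j] (pr i j)" if ij: "i \<in> \<Gamma>" "j \<in> X" for i j f
  proof -
    have T: "eval f T [m, i, j] y \<longleftrightarrow>
        y = (\<pi> (m + d) - i) + (i - \<pi> (m + d)) + ((\<rho> (m + d) - j) + (j - \<rho> (m + d)))"
      if "m + d \<in> Q" for m y
      by (simp add: T_def D_def q_def p[OF that] r[OF that])
    have "eval f (Mu T) [i, j] (pr i j - d)"
    proof (rule mu)
      show "eval f T [pr i j - d, i, j] 0"
        using T[of "pr i j - d" 0] pr[OF ij] d(1) by simp
      show "\<forall>m<pr i j - d. \<exists>y. eval f T [m, i, j] (Suc y)"
      proof (intro allI impI)
        fix m
        assume m: "m < pr i j - d"
        then have mQ: "m + d \<in> Q"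
          using d(2)[of "pr i j" "m + d"] pr[OF ij] by simp
        have "\<pi> (m + d) \<noteq> i \<or> \<rho> (m + d) \<noteq> j"
          using uniq[OF mQ, of "pr i j"] pr[OF ij] m by auto
        then show "\<exists>y. eval f T [m, i, j] (Suc y)"
          unfolding T[OF mQ] by presburger
      qed
    qed
    then show ?thesis
      using d(1)[of "pr i j"] pr[OF ij] by (auto intro!: exI[of _ "pr i j - d"])
  qed
  then show ?thesis
    unfolding computable_on2_def by blast
qed

text \<open>The pairing is extracted from the projections, so that the quantifiers can be defined
  from the arrows of the diagram alone.\<close>

definition unpair :: "nat set \<Rightarrow> (nat \<Rightarrow> nat) \<Rightarrow> (nat \<Rightarrow> nat) \<Rightarrow> nat \<Rightarrow> nat \<Rightarrow> nat" where
  "unpair Q \<pi> \<rho> i j = (SOME q. q \<in> Q \<and> \<pi> q = i \<and> \<rho> q = j)"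

section \<open>Elements as arrows from the one-point object, and product diagrams\<close>

lemma one_in_comp_objects: "{1} \<in> comp_objects"
  unfolding comp_objects_def by (rule insertI2) (force intro: exI[of _ "1::nat"])

lemma point_hom: "q \<in> Q \<Longrightarrow> Q \<in> comp_objects \<Longrightarrow> ({1}, \<lambda>_\<in>{1}. q, Q) \<in> hom comp_category {1} Q"
  using one_in_comp_objects by (auto simp: hom_comp_category finite_computable_on)

lemma is_product_pair:
  assumes "is_product C [X, Y] Q [p, r]" "f \<in> hom C Z X" "g \<in> hom C Z Y" "Z \<in> Obj C"
  shows "\<exists>!h. h \<in> hom C Z Q \<and> Cmp C p h = f \<and> Cmp C r h = g"
proof -
  have "\<exists>!h. h \<in> hom C Z Q \<and> map (\<lambda>q. Cmp C q h) [p, r] = [f, g]"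
    using assms unfolding is_product_def by (elim conjE) (drule (1) bspec, drule spec[of _ "[f, g]"], simp)
  then show ?thesis by simp
qed

lemma is_product_pair_unique:
  assumes "is_product C [X, Y] Q [p, r]" "h \<in> hom C Z Q" "h' \<in> hom C Z Q" "Z \<in> Obj C"
    "Cmp C p h = f" "Cmp C p h' = f" "Cmp C r h = g" "Cmp C r h' = g" "f \<in> hom C Z X" "g \<in> hom C Z Y"
  shows "h = h'"
  using is_product_pair[OF assms(1,9,10,4)] assms by blast

lemma is_product_pairI:
  assumes "p \<in> hom C Q X" "r \<in> hom C Q Y" "X \<in> Obj C" "Y \<in> Obj C" "Q \<in> Obj C"
    and "\<And>Z f g. \<lbrakk>Z \<in> Obj C; f \<in> hom C Z X; g \<in> hom C Z Y\<rbrakk>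
      \<Longrightarrow> \<exists>!h. h \<in> hom C Z Q \<and> Cmp C p h = f \<and> Cmp C r h = g"
  shows "is_product C [X, Y] Q [p, r]"
  unfolding is_product_def
proof (intro conjI ballI allI impI)
  fix Z fs
  assume "Z \<in> Obj C" "list_all2 (\<lambda>f X. f \<in> hom C Z X) fs [X, Y]"
  then obtain f g where "fs = [f, g]" "f \<in> hom C Z X" "g \<in> hom C Z Y"
    by (auto simp: list_all2_Cons2)
  then show "\<exists>!h. h \<in> hom C Z Q \<and> map (\<lambda>p. Cmp C p h) [p, r] = fs"
    using assms(6)[OF \<open>Z \<in> Obj C\<close>] by simp
qed (use assms in simp_all)

text \<open>The universal property for the one-point object gives the bijection of \<^term>\<open>Q\<close> with
  \<open>\<Gamma> \<times> X\<close>.\<close>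

lemma product_index_product:
  assumes "is_product comp_category [\<Gamma>, X] Q [p, r]"
  obtains \<pi> \<rho> where "p = (Q, \<pi>, \<Gamma>)" "r = (Q, \<rho>, X)" "\<Gamma> \<in> comp_objects" "X \<in> comp_objects"
    "Q \<in> comp_objects" "index_product \<Gamma> X Q \<pi> \<rho> (unpair Q \<pi> \<rho>)"
proof -
  from assms obtain \<pi> \<rho> where eq: "p = (Q, \<pi>, \<Gamma>)" "r = (Q, \<rho>, X)"
    and obj: "\<Gamma> \<in> comp_objects" "X \<in> comp_objects" "Q \<in> comp_objects"
    and fn: "\<pi> \<in> Q \<rightarrow>\<^sub>E \<Gamma>" "\<rho> \<in> Q \<rightarrow>\<^sub>E X" and comp: "computable_on Q \<pi>" "computable_on Q \<rho>"
    unfolding is_product_def by (auto simp: hom_comp_category)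
  have ex1: "\<exists>!h. h \<in> hom comp_category {1} Q \<and> Cmp comp_category p h = ({1}, \<lambda>_\<in>{1}. i, \<Gamma>) \<and>
      Cmp comp_category r h = ({1}, \<lambda>_\<in>{1}. j, X)" if "i \<in> \<Gamma>" "j \<in> X" for i j
  proof -
    show ?thesis
      by (rule is_product_pair[OF assms point_hom point_hom]) (use that obj one_in_comp_objects in simp_all)
  qed
  have cmp: "Cmp comp_category p ({1}, \<lambda>_\<in>{1}. q, Q) = ({1}, \<lambda>_\<in>{1}. \<pi> q, \<Gamma>)"
    "Cmp comp_category r ({1}, \<lambda>_\<in>{1}. q, Q) = ({1}, \<lambda>_\<in>{1}. \<rho> q, X)" for q
    by (auto simp: eq compose_def)
  have uniq: "q = q'" if "q \<in> Q" "q' \<in> Q" "\<pi> q = \<pi> q'" "\<rho> q = \<rho> q'" for q q'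
  proof -
    have "\<pi> q \<in> \<Gamma>" "\<rho> q \<in> X"
      using that fn by auto
    then have \<Gamma>X: "({1}, \<lambda>_\<in>{1}. \<pi> q, \<Gamma>) \<in> hom comp_category {1} \<Gamma>"
      "({1}, \<lambda>_\<in>{1}. \<rho> q, X) \<in> hom comp_category {1} X"
      using obj by (blast intro: point_hom)+
    have "({1}, \<lambda>_\<in>{1}. q, Q) = (({1}, \<lambda>_\<in>{1}. q', Q) :: arrow)"
    proof (rule is_product_pair_unique[OF assms])
      show "Cmp comp_category p ({1}, \<lambda>_\<in>{1}. q, Q) = ({1}, \<lambda>_\<in>{1}. \<pi> q, \<Gamma>)"
        "Cmp comp_category r ({1}, \<lambda>_\<in>{1}. q, Q) = ({1}, \<lambda>_\<in>{1}. \<rho> q, X)"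
        by (rule cmp)+
      show "Cmp comp_category p ({1}, \<lambda>_\<in>{1}. q', Q) = ({1}, \<lambda>_\<in>{1}. \<pi> q, \<Gamma>)"
        "Cmp comp_category r ({1}, \<lambda>_\<in>{1}. q', Q) = ({1}, \<lambda>_\<in>{1}. \<rho> q, X)"
        unfolding that(3,4) by (rule cmp)+
    qed (use \<Gamma>X point_hom[OF that(1) obj(3)] point_hom[OF that(2) obj(3)] one_in_comp_objects in simp_all)
    then show ?thesis
      by (auto dest: fun_cong[of _ _ 1])
  qed
  have ex: "\<exists>q. q \<in> Q \<and> \<pi> q = i \<and> \<rho> q = j" if "i \<in> \<Gamma>" "j \<in> X" for i j
  proof -
    from ex1[OF that] obtain h where h: "h \<in> hom comp_category {1} Q"
      "Cmp comp_category p h = ({1}, \<lambda>_\<in>{1}. i, \<Gamma>)" "Cmp comp_category r h = ({1}, \<lambda>_\<in>{1}. j, X)"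
      by blast
    then obtain \<alpha> where \<alpha>: "h = ({1}, \<alpha>, Q)" "\<alpha> \<in> {1} \<rightarrow>\<^sub>E Q"
      unfolding hom_comp_category by blast
    have "compose {1} \<pi> \<alpha> 1 = i" "compose {1} \<rho> \<alpha> 1 = j"
      using h(2,3) by (auto simp: eq \<alpha>)
    then show ?thesis
      using \<alpha>(2) by (intro exI[of _ "\<alpha> 1"]) (auto simp: compose_def)
  qed
  have pr: "unpair Q \<pi> \<rho> i j \<in> Q \<and> \<pi> (unpair Q \<pi> \<rho> i j) = i \<and> \<rho> (unpair Q \<pi> \<rho> i j) = j"
    if "i \<in> \<Gamma>" "j \<in> X" for i j
    unfolding unpair_def by (rule someI_ex[OF ex[OF that]])
  have "index_product \<Gamma> X Q \<pi> \<rho> (unpair Q \<pi> \<rho>)"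
  proof
    show "computable_on2 \<Gamma> X (unpair Q \<pi> \<rho>)"
      using obj(3) comp pr uniq by (rule computable_on2_inverse)
    show "unpair Q \<pi> \<rho> (\<pi> q) (\<rho> q) = q" if "q \<in> Q" for q
      using uniq[OF _ that] pr[of "\<pi> q" "\<rho> q"] that fn by auto
  qed (use fn comp pr in auto)
  then show ?thesis
    using that eq obj by blast
qed

lemma (in index_product) is_product:
  assumes "\<Gamma> \<in> comp_objects" "X \<in> comp_objects" "Q \<in> comp_objects"
  shows "is_product comp_category [\<Gamma>, X] Q [(Q, restrict \<pi> Q, \<Gamma>), (Q, restrict \<rho> Q, X)]"
proof -
  have hom: "(Q, restrict \<pi> Q, \<Gamma>) \<in> hom comp_category Q \<Gamma>" "(Q, restrict \<rho> Q, X) \<in> hom comp_category Q X"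
    using assms \<pi> \<rho> computable_on_cong[OF computable_\<pi>] computable_on_cong[OF computable_\<rho>]
    by (auto simp: hom_comp_category)
  have "\<exists>!h. h \<in> hom comp_category Z Q \<and> Cmp comp_category (Q, restrict \<pi> Q, \<Gamma>) h = f \<and>
      Cmp comp_category (Q, restrict \<rho> Q, X) h = g"
    if fg: "f \<in> hom comp_category Z \<Gamma>" "g \<in> hom comp_category Z X" for Z f g
  proof -
    obtain \<alpha> where \<alpha>: "f = (Z, \<alpha>, \<Gamma>)" "\<alpha> \<in> Z \<rightarrow>\<^sub>E \<Gamma>" "computable_on Z \<alpha>" "Z \<in> comp_objects"
      using fg(1) unfolding hom_comp_category by blast
    obtain \<beta> where \<beta>: "g = (Z, \<beta>, X)" "\<beta> \<in> Z \<rightarrow>\<^sub>E X" "computable_on Z \<beta>"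
      using fg(2) unfolding hom_comp_category by blast
    have mem: "\<alpha> z \<in> \<Gamma>" "\<beta> z \<in> X" if "z \<in> Z" for z
      using that \<alpha>(2) \<beta>(2) by auto
    define \<eta> where "\<eta> = (\<lambda>z\<in>Z. pr (\<alpha> z) (\<beta> z))"
    obtain a where a: "\<And>i f. i \<in> Z \<Longrightarrow> eval f a [i] (\<alpha> i)"
      using \<alpha>(3) by (rule computable_onE) blast
    obtain b where b: "\<And>i f. i \<in> Z \<Longrightarrow> eval f b [i] (\<beta> i)"
      using \<beta>(3) by (rule computable_onE) blast
    obtain p where p: "\<And>i j f. i \<in> \<Gamma> \<Longrightarrow> j \<in> X \<Longrightarrow> eval f p [i, j] (pr i j)"
      using computable_pr unfolding computable_on2_def by blast
    have "computable_on Z \<eta>"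
    proof (rule computable_onI[where p = "Comp p [a, b]"])
      fix z
      assume z: "z \<in> Z"
      show "eval (\<lambda>_. 0) (Comp p [a, b]) [z] (\<eta> z)"
        using z by (simp add: eval_iff[OF a[OF z]] eval_iff[OF b[OF z]] eval_iff[OF p[OF mem[OF z]]] \<eta>_def)
    qed
    then have \<eta>_hom: "(Z, \<eta>, Q) \<in> hom comp_category Z Q"
      using \<alpha>(4) assms(3) pr(1) mem by (auto simp: hom_comp_category \<eta>_def)
    have \<pi>_\<eta>: "compose Z (restrict \<pi> Q) \<eta> = \<alpha>"
    proof
      show "compose Z (restrict \<pi> Q) \<eta> z = \<alpha> z" for z
        using mem pr(1-3) PiE_arb[OF \<alpha>(2)] by (cases "z \<in> Z") (simp_all add: compose_def \<eta>_def)
    qed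
    have \<rho>_\<eta>: "compose Z (restrict \<rho> Q) \<eta> = \<beta>"
    proof
      show "compose Z (restrict \<rho> Q) \<eta> z = \<beta> z" for z
        using mem pr(1-3) PiE_arb[OF \<beta>(2)] by (cases "z \<in> Z") (simp_all add: compose_def \<eta>_def)
    qed
    have uniq: "h = (Z, \<eta>, Q)"
      if h: "h \<in> hom comp_category Z Q" "Cmp comp_category (Q, restrict \<pi> Q, \<Gamma>) h = f"
        "Cmp comp_category (Q, restrict \<rho> Q, X) h = g" for h
    proof -
      obtain \<theta> where \<theta>: "h = (Z, \<theta>, Q)" "\<theta> \<in> Z \<rightarrow>\<^sub>E Q"
        using h(1) unfolding hom_comp_category by blast
      have "\<theta> z = \<eta> z" for z
      proof (cases "z \<in> Z")
        case True
        have "compose Z (restrict \<pi> Q) \<theta> z = \<alpha> z" "compose Z (restrict \<rho> Q) \<theta> z = \<beta> z"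
          using h(2,3) by (simp_all add: \<theta>(1) \<alpha>(1) \<beta>(1))
        then have "\<pi> (\<theta> z) = \<alpha> z" "\<rho> (\<theta> z) = \<beta> z"
          using True PiE_mem[OF \<theta>(2)] by (simp_all add: compose_def)
        then show ?thesis
          using pr(4)[of "\<theta> z"] True PiE_mem[OF \<theta>(2)] by (simp add: \<eta>_def)
      next
        case False
        then show ?thesis using PiE_arb[OF \<theta>(2)] by (simp add: \<eta>_def)
      qed
      then show ?thesis by (simp add: \<theta>(1) ext)
    qed
    show ?thesis
    proof (rule ex1I[of _ "(Z, \<eta>, Q)"])
      show "(Z, \<eta>, Q) \<in> hom comp_category Z Q \<and> Cmp comp_category (Q, restrict \<pi> Q, \<Gamma>) (Z, \<eta>, Q) = f \<and>
          Cmp comp_category (Q, restrict \<rho> Q, X) (Z, \<eta>, Q) = g"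
        by (simp add: \<eta>_hom \<pi>_\<eta> \<rho>_\<eta> \<alpha>(1) \<beta>(1))
    qed (elim conjE, rule uniq)
  qed
  then show ?thesis
    using assms hom by (intro is_product_pairI) simp_all
qed

text \<open>For powers it is enough to multiply finite objects with finite ones and the infinite
  object with itself; the finiteness of \<open>Q\<close> in the conclusion lets the induction on the
  exponent continue.\<close>

lemma binary_product_exists:
  assumes "X \<in> comp_objects" "Y \<in> comp_objects" "finite X = finite Y"
  shows "\<exists>Q p r. is_product comp_category [X, Y] Q [p, r] \<and> finite Q = finite X"
proof (cases "X = UNIV")
  case True
  then have Y: "Y = UNIV"
    using assms(2,3) comp_objects_finite by auto
  have "index_product UNIV UNIV UNIV pfst psnd pair"
  proof
    show "computable_on UNIV pfst"
      by (rule computable_onI[where p = p_fst]) simp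
    show "computable_on UNIV psnd"
      by (rule computable_onI[where p = p_snd]) simp
    show "computable_on2 UNIV UNIV pair"
      unfolding computable_on2_def by (rule exI[of _ p_pair]) simp
  qed auto
  then show ?thesis
    using index_product.is_product assms True Y by blast
next
  case False
  then have fin: "finite X" "finite Y"
    using assms comp_objects_finite by auto
  obtain m k where mk: "X = {1..m}" "1 \<le> m" "Y = {1..k}" "1 \<le> k"
    using assms fin by (metis comp_objects_cases infinite_UNIV_nat)
  let ?Q = "{1..m * k}"
  have Q: "?Q \<in> comp_objects"
    using mk unfolding comp_objects_def by (auto intro!: exI[of _ "m * k"])
  have "card ?Q = card (X \<times> Y)"
    by (simp add: mk)
  \<comment> \<open>Any bijection will do, since every function on a finite set is
    computable.\<close>
  then obtain b where b: "bij_betw b ?Q (X \<times> Y)"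
    using finite_same_card_bij[of ?Q "X \<times> Y"] fin by blast
  let ?pr = "\<lambda>i j. inv_into ?Q b (i, j)"
  have pr: "?pr i j \<in> ?Q" "b (?pr i j) = (i, j)" if "i \<in> X" "j \<in> Y" for i j
  proof -
    have "(i, j) \<in> b ` ?Q"
      using b that by (simp add: bij_betw_def)
    then show "?pr i j \<in> ?Q" "b (?pr i j) = (i, j)"
      by (rule inv_into_into, rule f_inv_into_f)
  qed
  have "index_product X Y ?Q (\<lambda>q. fst (b q)) (\<lambda>q. snd (b q)) ?pr"
  proof
    show "computable_on ?Q (\<lambda>q. fst (b q))" "computable_on ?Q (\<lambda>q. snd (b q))"
      by (rule finite_computable_on; simp)+
    show "computable_on2 X Y ?pr"
    proof (rule computable_on2_inverse[OF Q, of "\<lambda>q. fst (b q)" "\<lambda>q. snd (b q)"])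
      show "q = q'" if "q \<in> ?Q" "q' \<in> ?Q" "fst (b q) = fst (b q')" "snd (b q) = snd (b q')" for q q'
        using inj_onD[OF bij_betw_imp_inj_on[OF b] _ that(1,2)] that(3,4) by (simp add: prod_eq_iff)
      show "?pr i j \<in> ?Q \<and> fst (b (?pr i j)) = i \<and> snd (b (?pr i j)) = j" if "i \<in> X" "j \<in> Y" for i j
        using pr[OF that] by simp
    qed (simp_all add: finite_computable_on)
    show "?pr (fst (b q)) (snd (b q)) = q" if "q \<in> ?Q" for q
      using b that by (simp add: bij_betw_def)
    show "fst (b q) \<in> X" "snd (b q) \<in> Y" if "q \<in> ?Q" for q
      using bij_betwE[OF b] that by (auto simp: mem_Times_iff simp del: atLeastAtMost_iff)
    show "?pr i j \<in> ?Q" "fst (b (?pr i j)) = i" "snd (b (?pr i j)) = j" if "i \<in> X" "j \<in> Y" for i j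
      using pr[OF that] by simp_all
  qed
  from index_product.is_product[OF this assms(1,2) Q] show ?thesis
    using fin by (metis finite_atLeastAtMost)
qed

lemma (in category) is_product_Cons:
  assumes Q: "is_product C Xs Q ps" and R: "is_product C [X, Q] R [p, r]"
  shows "is_product C (X # Xs) R (p # map (\<lambda>q. Cmp C q r) ps)"
proof -
  have p: "p \<in> hom C R X" and r: "r \<in> hom C R Q" and obj: "X \<in> Obj C" "R \<in> Obj C" "set Xs \<subseteq> Obj C"
    and ps: "list_all2 (\<lambda>p X. p \<in> hom C Q X) ps Xs"
    using Q R unfolding is_product_def by auto
  have "list_all2 (\<lambda>p X. p \<in> hom C R X) (map (\<lambda>q. Cmp C q r) ps) Xs"
    using ps comp_hom[OF r] by (auto simp: list_all2_conv_all_nth)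
  moreover have "\<exists>!h. h \<in> hom C Z R \<and> map (\<lambda>q. Cmp C q h) (p # map (\<lambda>q. Cmp C q r) ps) = fs"
    if Z: "Z \<in> Obj C" and fs: "list_all2 (\<lambda>f X. f \<in> hom C Z X) fs (X # Xs)" for Z fs
  proof -
    obtain f fs' where fs': "fs = f # fs'" "f \<in> hom C Z X" "list_all2 (\<lambda>f X. f \<in> hom C Z X) fs' Xs"
      using fs by (auto simp: list_all2_Cons2)
    obtain u where u: "u \<in> hom C Z Q" "map (\<lambda>q. Cmp C q u) ps = fs'"
      and u_unique: "\<And>v. v \<in> hom C Z Q \<Longrightarrow> map (\<lambda>q. Cmp C q v) ps = fs' \<Longrightarrow> v = u"
      using Q Z fs'(3) unfolding is_product_def by metis
    have ex1: "\<exists>!h. h \<in> hom C Z R \<and> map (\<lambda>q. Cmp C q h) [p, r] = [f, u]"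
      using is_product_pair[OF R fs'(2) u(1) Z] by simp
    have map_eq: "map (\<lambda>q. Cmp C q h) (map (\<lambda>q. Cmp C q r) ps) = map (\<lambda>q. Cmp C q (Cmp C r h)) ps"
      if h: "h \<in> hom C Z R" for h
    proof -
      have "Cmp C (Cmp C q r) h = Cmp C q (Cmp C r h)" if "q \<in> set ps" for q
        using ps that assoc[OF h r] by (auto simp: list_all2_conv_all_nth in_set_conv_nth)
      then show ?thesis by simp
    qed
    have "h \<in> hom C Z R \<and> map (\<lambda>q. Cmp C q h) (p # map (\<lambda>q. Cmp C q r) ps) = fs \<longleftrightarrow>
        h \<in> hom C Z R \<and> map (\<lambda>q. Cmp C q h) [p, r] = [f, u]" for h
    proof (rule conj_cong[OF HOL.refl])
      assume h: "h \<in> hom C Z R"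
      have "map (\<lambda>q. Cmp C q (Cmp C r h)) ps = fs' \<longleftrightarrow> Cmp C r h = u"
        using u_unique[OF comp_hom[OF h r]] u(2) by blast
      then show "map (\<lambda>q. Cmp C q h) (p # map (\<lambda>q. Cmp C q r) ps) = fs \<longleftrightarrow>
          map (\<lambda>q. Cmp C q h) [p, r] = [f, u]"
        unfolding fs'(1) list.map(2) map_eq[OF h] by simp
    qed
    then show ?thesis
      using ex1 by simp
  qed
  ultimately show ?thesis
    using p obj unfolding is_product_def by simp
qed

lemma has_finite_powers_comp_category: "has_finite_powers comp_category"
  unfolding has_finite_powers_def
proof (intro ballI allI)
  fix X n
  assume "X \<in> Obj comp_category"
  then have X: "X \<in> comp_objects" by simp
  \<comment> \<open>The induction starts with the first power: the empty product \<open>{1}\<close>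
    is finite even for infinite \<open>X\<close> and would violate the invariant.\<close>
  have pos: "\<exists>Q ps. is_product comp_category (replicate (Suc n) X) Q ps \<and> finite Q = finite X" for n
  proof (induction n)
    case 0
    have "is_product comp_category [X] X [Id comp_category X]"
      unfolding is_product_def
      using X id_hom id_left by (auto simp: list_all2_Cons2 simp del: comp_category_simps(4,5))
    then show ?case by auto
  next
    case (Suc n)
    then obtain Q ps where Q: "is_product comp_category (replicate (Suc n) X) Q ps" "finite Q = finite X"
      by blast
    have "Q \<in> comp_objects"
      using Q(1) unfolding is_product_def by simp
    then obtain R p r where "is_product comp_category [X, Q] R [p, r]" "finite R = finite X"
      using binary_product_exists[OF X] Q(2) by blast
    then show ?case
      using is_product_Cons[OF Q(1)] by (metis replicate_Suc)
  qed
  show "\<exists>Q ps. is_product comp_category (replicate n X) Q ps"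
  proof (cases n)
    case 0
    have "\<exists>!h. h \<in> hom comp_category Z {1}" if "Z \<in> comp_objects" for Z
    proof (rule ex1I[of _ "(Z, \<lambda>_\<in>Z. 1, {1})"])
      have "computable_on Z (\<lambda>_\<in>Z. 1)"
        by (rule computable_onI[where p = "p_const 1"]) simp
      then show "(Z, \<lambda>_\<in>Z. 1, {1}) \<in> hom comp_category Z {1}"
        using that one_in_comp_objects by (auto simp: hom_comp_category)
      show "h = (Z, \<lambda>_\<in>Z. 1, {1})" if h: "h \<in> hom comp_category Z {1}" for h
      proof -
        obtain \<alpha> where \<alpha>: "h = (Z, \<alpha>, {1})" "\<alpha> \<in> Z \<rightarrow>\<^sub>E {1}"
          using h unfolding hom_comp_category by blast
        have "\<alpha> z = (\<lambda>_\<in>Z. 1) z" for z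
          using PiE_mem[OF \<alpha>(2)] PiE_arb[OF \<alpha>(2)] by (cases "z \<in> Z") simp_all
        then show ?thesis by (simp add: \<alpha>(1) ext)
      qed
    qed
    then have "is_product comp_category [] {1} []"
      using one_in_comp_objects by (auto simp: is_product_def)
    then show ?thesis using 0 by auto
  next
    case (Suc m)
    then show ?thesis using pos[of m] by blast
  qed
qed

section \<open>Reindexing\<close>

text \<open>Reindexing does not depend on the representatives, because it is monotone along
  computable functions.\<close>

lemma mass_star_predicate_of:
  assumes "(X, \<alpha>, Y) \<in> hom comp_category X Y"
  shows "mass_star (X, \<alpha>, Y) (predicate_of Y A) = predicate_of X (\<lambda>i. A (\<alpha> i))"
proof -
  have *: "X \<in> comp_objects" "Y \<in> comp_objects" "computable_on X \<alpha>" "\<And>i. i \<in> X \<Longrightarrow> \<alpha> i \<in> Y"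
    using assms by (auto simp: hom_comp_category)
  have "fam_le Y (representative (predicate_of Y A)) A" "fam_le Y A (representative (predicate_of Y A))"
    using predicate_of_representative[OF *(2), of A] unfolding predicate_of_eq_iff[OF *(2)] by blast+
  then show ?thesis
    unfolding mass_star_def using fam_le_reindex[OF _ *(3,4)] by (simp add: predicate_of_eq_iff[OF *(1)])
qed

lemma contravariant_poset_functor_mass_P: "contravariant_poset_functor comp_category mass_P mass_star"
proof (intro contravariant_poset_functor.intro contravariant_poset_functor_axioms.intro
    category_comp_category)
  show "partial_order (mass_P X)" if "X \<in> Obj comp_category" for X
  proof -
    interpret brouwer_presentation "mass_P X" "predicate_of X" "fam_le X" fam_join fam_meet fam_imp
      "\<lambda>_. UNIV" "\<lambda>_. {}"
      using that by (intro mass_P_presentation) simp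
    show ?thesis by unfold_locales
  qed
  note po = this
  fix f X Y
  assume "f \<in> hom comp_category X Y"
  then obtain \<alpha> where f: "f = (X, \<alpha>, Y)" and hom: "(X, \<alpha>, Y) \<in> hom comp_category X Y"
    and obj: "X \<in> comp_objects" "Y \<in> comp_objects" and \<alpha>: "computable_on X \<alpha>" "\<And>i. i \<in> X \<Longrightarrow> \<alpha> i \<in> Y"
    unfolding hom_comp_category by blast
  show "mass_star f \<in> carrier (mass_P Y) \<rightarrow> carrier (mass_P X)"
    using obj by (auto simp: f carrier_mass_P mass_star_predicate_of[OF hom])
  have "weak_partial_order (mass_P X)" "weak_partial_order (mass_P Y)"
    using po obj by (auto simp: partial_order_def)
  then show "isotone (mass_P Y) (mass_P X) (mass_star f)"
    using fam_le_reindex[OF _ \<alpha>] obj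
    by (auto simp: isotone_def f carrier_mass_P mass_star_predicate_of[OF hom] mass_P_le)
  fix g Z A
  assume "g \<in> hom comp_category Y Z" and A: "A \<in> carrier (mass_P Z)"
  then obtain \<beta> where g: "g = (Y, \<beta>, Z)" and hom': "(Y, \<beta>, Z) \<in> hom comp_category Y Z"
    and Z: "Z \<in> comp_objects"
    unfolding hom_comp_category by blast
  have hom'': "(X, compose X \<beta> \<alpha>, Z) \<in> hom comp_category X Z"
    using comp_hom[OF hom hom'] by simp
  obtain F where "A = predicate_of Z F"
    using A Z by (rule mass_P_cases)
  then show "mass_star (Cmp comp_category g f) A = mass_star f (mass_star g A)"
    by (simp add: f g mass_star_predicate_of[OF hom] mass_star_predicate_of[OF hom']
        mass_star_predicate_of[OF hom''])
      (auto intro: predicate_of_cong simp: compose_def)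
next
  fix X A
  assume X: "X \<in> Obj comp_category" and A: "A \<in> carrier (mass_P X)"
  then obtain F where F: "A = predicate_of X F"
    by (auto elim: mass_P_cases)
  show "mass_star (Id comp_category X) A = A"
    using id_hom[OF X] by (auto simp: F mass_star_predicate_of intro: predicate_of_cong)
qed

lemma mass_star_brouwer_hom:
  assumes "f \<in> hom comp_category X Y"
  shows "brouwer_hom (mass_P Y) (mass_P X) (mass_star f)"
proof -
  obtain \<alpha> where f: "f = (X, \<alpha>, Y)" and hom: "(X, \<alpha>, Y) \<in> hom comp_category X Y"
    and obj: "X \<in> comp_objects" "Y \<in> comp_objects"
    using assms unfolding hom_comp_category by blast
  interpret X: brouwer_presentation "mass_P X" "predicate_of X" "fam_le X" fam_join fam_meet fam_imp
    "\<lambda>_. UNIV" "\<lambda>_. {}"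
    by (rule mass_P_presentation) (rule obj)
  interpret Y: brouwer_presentation "mass_P Y" "predicate_of Y" "fam_le Y" fam_join fam_meet fam_imp
    "\<lambda>_. UNIV" "\<lambda>_. {}"
    by (rule mass_P_presentation) (rule obj)
  note star = mass_star_predicate_of[OF hom]
  have "(\<lambda>i. fam_join A B (\<alpha> i)) = fam_join (\<lambda>i. A (\<alpha> i)) (\<lambda>i. B (\<alpha> i))"
    "(\<lambda>i. fam_meet A B (\<alpha> i)) = fam_meet (\<lambda>i. A (\<alpha> i)) (\<lambda>i. B (\<alpha> i))"
    "(\<lambda>i. fam_imp A B (\<alpha> i)) = fam_imp (\<lambda>i. A (\<alpha> i)) (\<lambda>i. B (\<alpha> i))" for A B
    by (simp_all add: fun_eq_iff fam_join_def fam_meet_def fam_imp_def)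
  then show ?thesis
    unfolding brouwer_hom_def f
    by (auto simp: star X.carrier Y.carrier X.join_k Y.join_k X.meet_k Y.meet_k X.bottom_k Y.bottom_k
        X.top_k Y.top_k X.implication_k Y.implication_k)
qed

section \<open>Equality and quantifiers\<close>

text \<open>The left side says that \<open>A\<close> is uniformly solvable along the diagonal. The
  witness is trivial on the diagonal and empty off it, so reducing \<open>A\<close> to it asks for
  just that.\<close>

lemma mass_equality:
  assumes prod: "is_product comp_category [X, X] Q [p, r]" and \<Delta>: "\<Delta> \<in> hom comp_category X Q"
    "Cmp comp_category p \<Delta> = Id comp_category X" "Cmp comp_category r \<Delta> = Id comp_category X"
  shows "\<exists>E\<in>carrier (mass_P Q). \<forall>A\<in>carrier (mass_P Q).
    mass_star \<Delta> A \<sqsubseteq>\<^bsub>mass_P X\<^esub> \<bottom>\<^bsub>mass_P X\<^esub> \<longleftrightarrow> A \<sqsubseteq>\<^bsub>mass_P Q\<^esub> E"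
proof -
  obtain \<pi> \<rho> where eq: "p = (Q, \<pi>, X)" "r = (Q, \<rho>, X)"
    and obj: "X \<in> comp_objects" "Q \<in> comp_objects"
    and "index_product X X Q \<pi> \<rho> (unpair Q \<pi> \<rho>)"
    by (rule product_index_product[OF prod])
  then interpret index_product X X Q \<pi> \<rho> "unpair Q \<pi> \<rho>" by blast
  interpret X: brouwer_presentation "mass_P X" "predicate_of X" "fam_le X" fam_join fam_meet fam_imp
    "\<lambda>_. UNIV" "\<lambda>_. {}"
    by (rule mass_P_presentation) (rule obj)
  obtain \<delta> where \<delta>: "\<Delta> = (X, \<delta>, Q)" "\<And>i. i \<in> X \<Longrightarrow> \<delta> i \<in> Q" "computable_on X \<delta>"
    using \<Delta>(1) unfolding hom_comp_category by blast
  have "compose X \<pi> \<delta> = restrict id X" "compose X \<rho> \<delta> = restrict id X"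
    using \<Delta>(2,3) by (simp_all add: eq \<delta>(1))
  then have diag: "\<pi> (\<delta> i) = i" "\<rho> (\<delta> i) = i" if "i \<in> X" for i
    using that by (metis compose_eq id_apply restrict_apply')+
  \<comment> \<open>Both elements have the same projections, and these determine an element of
    \<open>Q\<close>.\<close>
  have inv: "\<delta> (\<pi> q) = q" if "q \<in> Q" "\<pi> q = \<rho> q" for q
    using pr(4)[of q] pr(4)[of "\<delta> (\<pi> q)"] that diag[of "\<pi> q"] \<pi>[of q] \<delta>(2) by simp
  define E :: "nat \<Rightarrow> mass_problem" where "E q = (if \<pi> q = \<rho> q then UNIV else {})" for q
  have "fam_le X (\<lambda>i. F (\<delta> i)) (\<lambda>_. UNIV) \<longleftrightarrow> fam_le Q F E" for F
  proof
    assume "fam_le X (\<lambda>i. F (\<delta> i)) (\<lambda>_. UNIV)"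
    then have "fam_le Q (\<lambda>q. F (\<delta> (\<pi> q))) (\<lambda>_. UNIV)"
      using fam_le_reindex[OF _ computable_\<pi> \<pi>] by fast
    then show "fam_le Q F E"
      by (rule fam_le_mono) (use inv in \<open>auto simp: E_def split: if_splits\<close>)
  next
    assume "fam_le Q F E"
    then have "fam_le X (\<lambda>i. F (\<delta> i)) (\<lambda>i. E (\<delta> i))"
      by (rule fam_le_reindex[OF _ \<delta>(3,2)])
    then show "fam_le X (\<lambda>i. F (\<delta> i)) (\<lambda>_. UNIV)"
      by (rule fam_le_mono) (auto simp: E_def diag)
  qed
  then show ?thesis
    using obj \<Delta>(1) by (intro bexI[of _ "predicate_of Q E"])
      (auto simp: \<delta>(1) carrier_mass_P mass_star_predicate_of X.bottom_k mass_P_le)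
qed

section \<open>Quantifiers on classes\<close>

lemma computable_retraction:
  assumes "X \<in> comp_objects"
  obtains c cl where "\<And>f j. eval f c [j] (cl j)" "\<And>j. cl j \<in> X" "\<And>j. j \<in> X \<Longrightarrow> cl j = j"
  using assms
proof (cases rule: comp_objects_cases)
  case 1
  then show ?thesis using that[of "Proj 0" "\<lambda>j. j"] by simp
next
  case (2 n)
  \<comment> \<open>With truncated subtraction this is 1 plus the minimum of \<open>n - 1\<close>
    and \<open>j - 1\<close>, that is, \<open>j\<close> clamped to the interval.\<close>
  let ?cl = "\<lambda>j. Suc (n - 1 - (n - 1 - (j - 1)))"
  let ?c = "Comp Succ [Comp p_sub [p_const (n - 1), Comp p_sub [p_const (n - 1), p_pred]]]"
  show ?thesis
    by (rule that[of ?c ?cl]) (use 2 in auto)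
qed

context index_product
begin

text \<open>A formal consequence of the adjunction; it makes the quantifier independent of
  representatives.\<close>

lemma fam_ex_mono:
  assumes "fam_le Q A B"
  shows "fam_le \<Gamma> (fam_ex pr X A) (fam_ex pr X B)"
  using assms fam_ex_adjoint fam_le_refl fam_le_trans by metis

lemma fam_all_adjoint:
  assumes "X \<in> comp_objects"
  shows "fam_le Q A (\<lambda>q. B (\<pi> q)) \<longleftrightarrow> fam_le \<Gamma> (fam_all pr X A) B"
proof -
  obtain c cl where "\<And>f j. eval f c [j] (cl j)" "\<And>j. cl j \<in> X" "\<And>j. j \<in> X \<Longrightarrow> cl j = j"
    using computable_retraction[OF assms] by blast
  then show ?thesis
    by (rule fam_all_adjoint_retraction)
qed

lemma fam_all_mono:
  assumes "X \<in> comp_objects" "fam_le Q A B"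
  shows "fam_le \<Gamma> (fam_all pr X A) (fam_all pr X B)"
proof -
  have "fam_le Q B (\<lambda>q. fam_all pr X B (\<pi> q))"
    by (rule fam_all_adjoint[OF assms(1), THEN iffD2]) (rule fam_le_refl)
  with assms(2) have "fam_le Q A (\<lambda>q. fam_all pr X B (\<pi> q))"
    by (rule fam_le_trans)
  then show ?thesis
    by (rule fam_all_adjoint[OF assms(1), THEN iffD1])
qed

end

definition mass_quantifier ::
    "((nat \<Rightarrow> nat \<Rightarrow> nat) \<Rightarrow> nat set \<Rightarrow> (nat \<Rightarrow> mass_problem) \<Rightarrow> nat \<Rightarrow> mass_problem) \<Rightarrow>
     nat set \<Rightarrow> arrow \<Rightarrow> arrow \<Rightarrow> predicate \<Rightarrow> predicate" where
  "mass_quantifier q X = (\<lambda>(Q, \<pi>, \<Gamma>) (_, \<rho>, _) v.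
     predicate_of \<Gamma> (q (unpair Q \<pi> \<rho>) X (representative v)))"

lemma mass_quantifier_predicate_of:
  assumes "Q \<in> comp_objects" "\<Gamma> \<in> comp_objects"
    and mono: "\<And>A B. fam_le Q A B \<Longrightarrow> fam_le \<Gamma> (q (unpair Q \<pi> \<rho>) X A) (q (unpair Q \<pi> \<rho>) X B)"
  shows "mass_quantifier q X (Q, \<pi>, \<Gamma>) (Q', \<rho>, X') (predicate_of Q A) =
    predicate_of \<Gamma> (q (unpair Q \<pi> \<rho>) X A)"
  using predicate_of_representative[OF assms(1), of A] mono
  by (simp add: mass_quantifier_def predicate_of_eq_iff assms(1,2))

lemma mass_quantifier_adjoint:
  assumes prod: "is_product comp_category [\<Gamma>, X] Q [p, r]"
    and A: "A \<in> carrier (mass_P Q)" and B: "B \<in> carrier (mass_P \<Gamma>)"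
  shows "mass_star p B \<sqsubseteq>\<^bsub>mass_P Q\<^esub> A \<longleftrightarrow> B \<sqsubseteq>\<^bsub>mass_P \<Gamma>\<^esub> mass_quantifier fam_ex X p r A"
    and "A \<sqsubseteq>\<^bsub>mass_P Q\<^esub> mass_star p B \<longleftrightarrow> mass_quantifier fam_all X p r A \<sqsubseteq>\<^bsub>mass_P \<Gamma>\<^esub> B"
proof -
  obtain \<pi> \<rho> where eq: "p = (Q, \<pi>, \<Gamma>)" "r = (Q, \<rho>, X)"
    and obj: "\<Gamma> \<in> comp_objects" "X \<in> comp_objects" "Q \<in> comp_objects"
    and "index_product \<Gamma> X Q \<pi> \<rho> (unpair Q \<pi> \<rho>)"
    by (rule product_index_product[OF prod])
  then interpret index_product \<Gamma> X Q \<pi> \<rho> "unpair Q \<pi> \<rho>" by blast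
  have hom: "(Q, \<pi>, \<Gamma>) \<in> hom comp_category Q \<Gamma>"
    using prod by (simp add: is_product_def eq)
  obtain F G where FG: "A = predicate_of Q F" "B = predicate_of \<Gamma> G"
    using A B obj by (auto elim!: mass_P_cases)
  show "mass_star p B \<sqsubseteq>\<^bsub>mass_P Q\<^esub> A \<longleftrightarrow> B \<sqsubseteq>\<^bsub>mass_P \<Gamma>\<^esub> mass_quantifier fam_ex X p r A"
    using fam_ex_mono fam_ex_adjoint
    by (simp add: eq FG mass_star_predicate_of[OF hom] mass_quantifier_predicate_of obj mass_P_le)
  show "A \<sqsubseteq>\<^bsub>mass_P Q\<^esub> mass_star p B \<longleftrightarrow> mass_quantifier fam_all X p r A \<sqsubseteq>\<^bsub>mass_P \<Gamma>\<^esub> B"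
    using fam_all_mono[OF obj(2)] fam_all_adjoint[OF obj(2)]
    by (simp add: eq FG mass_star_predicate_of[OF hom] mass_quantifier_predicate_of obj mass_P_le)
qed

text \<open>The arrow \<open>t\<close> sends the pair of \<open>i\<close> and \<open>j\<close> to
  the pair of \<open>\<sigma> i\<close> and \<open>j\<close>, since the projections agree. Hence
  both sides come from families that coincide on \<open>\<Gamma>\<close>, and no reduction has to be
  built.\<close>

lemma mass_quantifier_natural:
  assumes prod: "is_product comp_category [\<Gamma>, X] Q [p, r]"
    and prod': "is_product comp_category [\<Gamma>', X] Q' [p', r']"
    and s: "s \<in> hom comp_category \<Gamma> \<Gamma>'" and t: "t \<in> hom comp_category Q Q'"
    and comm: "Cmp comp_category p' t = Cmp comp_category s p" "Cmp comp_category r' t = r"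
    and A: "A \<in> carrier (mass_P Q')"
  shows "mass_quantifier fam_ex X p r (mass_star t A) = mass_star s (mass_quantifier fam_ex X p' r' A)"
    and "mass_quantifier fam_all X p r (mass_star t A) = mass_star s (mass_quantifier fam_all X p' r' A)"
proof -
  obtain \<pi> \<rho> where eq: "p = (Q, \<pi>, \<Gamma>)" "r = (Q, \<rho>, X)"
    and obj: "\<Gamma> \<in> comp_objects" "X \<in> comp_objects" "Q \<in> comp_objects"
    and i: "index_product \<Gamma> X Q \<pi> \<rho> (unpair Q \<pi> \<rho>)"
    by (rule product_index_product[OF prod])
  obtain \<pi>' \<rho>' where eq': "p' = (Q', \<pi>', \<Gamma>')" "r' = (Q', \<rho>', X)"
    and obj': "\<Gamma>' \<in> comp_objects" "Q' \<in> comp_objects"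
    and i': "index_product \<Gamma>' X Q' \<pi>' \<rho>' (unpair Q' \<pi>' \<rho>')"
    by (rule product_index_product[OF prod'])
  interpret index_product \<Gamma> X Q \<pi> \<rho> "unpair Q \<pi> \<rho>" by (rule i)
  interpret P': index_product \<Gamma>' X Q' \<pi>' \<rho>' "unpair Q' \<pi>' \<rho>'" by (rule i')
  obtain \<sigma> where \<sigma>: "s = (\<Gamma>, \<sigma>, \<Gamma>')" "\<And>i. i \<in> \<Gamma> \<Longrightarrow> \<sigma> i \<in> \<Gamma>'"
    using s unfolding hom_comp_category by blast
  obtain \<tau> where \<tau>: "t = (Q, \<tau>, Q')" "\<And>q. q \<in> Q \<Longrightarrow> \<tau> q \<in> Q'"
    using t unfolding hom_comp_category by blast
  obtain F where F: "A = predicate_of Q' F"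
    using A obj' by (auto elim: mass_P_cases)
  have "compose Q \<pi>' \<tau> = compose Q \<sigma> \<pi>" "compose Q \<rho>' \<tau> = \<rho>"
    using comm by (simp_all add: eq eq' \<sigma>(1) \<tau>(1))
  then have "\<pi>' (\<tau> q) = \<sigma> (\<pi> q)" "\<rho>' (\<tau> q) = \<rho> q" if "q \<in> Q" for q
    using that by (metis compose_eq)+
  then have \<tau>_pr: "\<tau> (unpair Q \<pi> \<rho> i j) = unpair Q' \<pi>' \<rho>' (\<sigma> i) j" if "i \<in> \<Gamma>" "j \<in> X" for i j
    using P'.pr(4)[of "\<tau> (unpair Q \<pi> \<rho> i j)"] \<tau>(2) pr that by metis
  note simps = eq eq' F \<sigma>(1) \<tau>(1) mass_star_predicate_of[OF s[unfolded \<sigma>(1)]]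
    mass_star_predicate_of[OF t[unfolded \<tau>(1)]] mass_quantifier_predicate_of obj obj'
  show "mass_quantifier fam_ex X p r (mass_star t A) = mass_star s (mass_quantifier fam_ex X p' r' A)"
    using fam_ex_mono P'.fam_ex_mono
    by (simp add: simps) (rule predicate_of_cong, simp add: fam_ex_def \<tau>_pr)
  show "mass_quantifier fam_all X p r (mass_star t A) = mass_star s (mass_quantifier fam_all X p' r' A)"
    using fam_all_mono[OF obj(2)] P'.fam_all_mono[OF obj(2)]
    by (simp add: simps) (rule predicate_of_cong, simp add: fam_all_def \<tau>_pr)
qed

theorem theorem4p9:
  shows "first_order_hyperdoctrine comp_category mass_P mass_star"
proof -
  show ?thesis
  proof (intro first_order_hyperdoctrine.intro first_order_hyperdoctrine_axioms.intro
      contravariant_poset_functor_mass_P)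
    show "has_finite_powers comp_category"
      by (rule has_finite_powers_comp_category)
    show "brouwer_algebra (mass_P X)" if "X \<in> Obj comp_category" for X
      using that by (intro brouwer_presentation.brouwer_algebra[OF mass_P_presentation]) simp
    show "brouwer_hom (mass_P Y) (mass_P X) (mass_star f)" if "f \<in> hom comp_category X Y" for f X Y
      using that by (rule mass_star_brouwer_hom)
    fix X
    show "\<exists>E\<in>carrier (mass_P Q). \<forall>A\<in>carrier (mass_P Q).
        mass_star \<Delta> A \<sqsubseteq>\<^bsub>mass_P X\<^esub> \<bottom>\<^bsub>mass_P X\<^esub> \<longleftrightarrow> A \<sqsubseteq>\<^bsub>mass_P Q\<^esub> E"
      if "is_product comp_category [X, X] Q [p, r]" "\<Delta> \<in> hom comp_category X Q"
        "Cmp comp_category p \<Delta> = Id comp_category X" "Cmp comp_category r \<Delta> = Id comp_category X"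
      for Q p r \<Delta>
      using that by (rule mass_equality)
    have "mass_quantifier q X p r \<in> carrier (mass_P Q) \<rightarrow> carrier (mass_P \<Gamma>)"
      if "is_product comp_category [\<Gamma>, X] Q [p, r]" for q \<Gamma> Q p r
      by (rule product_index_product[OF that])
        (auto simp: mass_quantifier_def intro: predicate_of_in_carrier)
    then show "\<exists>(ex :: arrow \<Rightarrow> arrow \<Rightarrow> predicate \<Rightarrow> predicate) (all :: arrow \<Rightarrow> arrow \<Rightarrow> predicate \<Rightarrow> predicate).
      (\<forall>\<Gamma> Q \<pi> \<rho>. is_product comp_category [\<Gamma>, X] Q [\<pi>, \<rho>] \<longrightarrow>
         ex \<pi> \<rho> \<in> carrier (mass_P Q) \<rightarrow> carrier (mass_P \<Gamma>) \<and>
         all \<pi> \<rho> \<in> carrier (mass_P Q) \<rightarrow> carrier (mass_P \<Gamma>) \<and>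
         (\<forall>A\<in>carrier (mass_P Q). \<forall>B\<in>carrier (mass_P \<Gamma>).
            (mass_star \<pi> B \<sqsubseteq>\<^bsub>mass_P Q\<^esub> A \<longleftrightarrow> B \<sqsubseteq>\<^bsub>mass_P \<Gamma>\<^esub> ex \<pi> \<rho> A) \<and>
            (A \<sqsubseteq>\<^bsub>mass_P Q\<^esub> mass_star \<pi> B \<longleftrightarrow> all \<pi> \<rho> A \<sqsubseteq>\<^bsub>mass_P \<Gamma>\<^esub> B))) \<and>
      (\<forall>\<Gamma> Q \<pi> \<rho> \<Gamma>' Q' \<pi>' \<rho>' s t.
         is_product comp_category [\<Gamma>, X] Q [\<pi>, \<rho>] \<longrightarrow> is_product comp_category [\<Gamma>', X] Q' [\<pi>', \<rho>'] \<longrightarrow>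
         s \<in> hom comp_category \<Gamma> \<Gamma>' \<longrightarrow>
         t \<in> hom comp_category Q Q' \<longrightarrow> Cmp comp_category \<pi>' t = Cmp comp_category s \<pi> \<longrightarrow>
         Cmp comp_category \<rho>' t = \<rho> \<longrightarrow>
         (\<forall>A\<in>carrier (mass_P Q').
            ex \<pi> \<rho> (mass_star t A) = mass_star s (ex \<pi>' \<rho>' A) \<and>
            all \<pi> \<rho> (mass_star t A) = mass_star s (all \<pi>' \<rho>' A)))"
      using mass_quantifier_adjoint[of _ X] mass_quantifier_natural[of _ X]
      by (intro exI[of _ "mass_quantifier fam_ex X"] exI[of _ "mass_quantifier fam_all X"]
          conjI allI impI ballI) blast+
  qed
qed

end
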